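(* Let $d\in\mathbb N$, $0<\alpha<1$, $0<p\le1$, let $|\cdot|$ be the $\ell_1$ norm on $\mathbb R^d$, and let $V=\left(\bigcup_{k\ge0}[0,1]^d\cap2^{-k}\mathbb Z^d\right)\setminus\{0\}$. For $q\in(0,1]$ and $n\in\mathbb N$ put $C(q,n)=n^{1/q-1}$, and set $$\rho=\left(C(p,2)^p+(1+2^{1-p})\,2^{-p\alpha}\,\frac1{1-2^{-p\alpha}}\right)^{1/p},$$ $$\tau=C(p\alpha,d)^\alpha\,2^{2/p}\left(\frac1{1-2^{p(\alpha-1)}}\right)^{1/p}\left(\frac1{1-2^{-p\alpha}}\right)^{1/p}\left(1+(d-1)^{p\alpha}\right)^{1/p}.$$ Then the Banach–Mazur distance between $\mathcal F_p([0,1]^d,|\cdot|^\alpha)$ and $\ell_p(V)$ satisfies $$d\big(\mathcal F_p([0,1]^d,|\cdot|^\alpha),\ell_p(V)\big)\le C(p,2^d)\,\rho^d\,\tau^d .$$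
   Context: Vector spaces are real. Lipschitz free $p$-space ($0<p\le1$): for a metric space $(\mathcal M,\sigma)$ with base point $0$, let $\mathcal P(\mathcal M)$ be the vector space with linear basis $\{\delta(x):x\in\mathcal M\setminus\{0\}\}$, and put $\delta(0)=0$. For $m\in\mathcal P(\mathcal M)$ let $\|m\|=\inf\left(\sum_{i=1}^n|a_i|^p\right)^{1/p}$, the infimum over all finite representations $m=\sum_{i=1}^n a_i\frac{\delta(x_i)-\delta(y_i)}{\sigma(x_i,y_i)}$ with $a_i\in\mathbb R$, $x_i\ne y_i$ in $\mathcal M$. This is a $p$-norm (positive definite, absolutely homogeneous, $\|x+y\|^p\le\|x\|^p+\|y\|^p$), and $\mathcal F_p(\mathcal M,\sigma)$ is the completion of $\mathcal P(\mathcal M)$. Here $\mathcal M=[0,1]^d$ with metric $(x,y)\mapsto|x-y|^\alpha$ and base point $0$. $\ell_p(V)$ is the space of families $(a_v)_{v\in V}$ of reals with $\|(a_v)\|=(\sum_v|a_v|^p)^{1/p}<\infty$. The Banach–Mazur distance of $X$ and $Y$ is $d(X,Y)=\inf\|T\|\|T^{-1}\|$, where $T$ ranges over all onto linear isomorphisms $T:X\to Y$ (linear bijections bounded in both directions), and $\|T\|=\sup_{\|x\|\le1}\|Tx\|$. *)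

theory Defs
  imports "HOL-Analysis.Analysis"
begin

text \<open>
  The spaces below depend on term parameters (a metric, an exponent), and p-norms with
  p < 1 are not instances of the library's normed spaces, so operations and
  norm are packaged in a record.
\<close>

record 'v qspace =
  vcarrier :: "'v set"
  vadd :: "'v \<Rightarrow> 'v \<Rightarrow> 'v"
  vscale :: "real \<Rightarrow> 'v \<Rightarrow> 'v"
  vnorm :: "'v \<Rightarrow> real"

definition vdiff :: "'v qspace \<Rightarrow> 'v \<Rightarrow> 'v \<Rightarrow> 'v" where
  "vdiff X x y = vadd X x (vscale X (-1) y)"

definition linear_map :: "'v qspace \<Rightarrow> 'w qspace \<Rightarrow> ('v \<Rightarrow> 'w) \<Rightarrow> bool" where
  "linear_map X Y T \<longleftrightarrow>
     T ` vcarrier X \<subseteq> vcarrier Y \<and>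
     (\<forall>x\<in>vcarrier X. \<forall>y\<in>vcarrier X. T (vadd X x y) = vadd Y (T x) (T y)) \<and>
     (\<forall>c. \<forall>x\<in>vcarrier X. T (vscale X c x) = vscale Y c (T x))"

definition bounded_map :: "'v qspace \<Rightarrow> 'w qspace \<Rightarrow> ('v \<Rightarrow> 'w) \<Rightarrow> bool" where
  "bounded_map X Y T \<longleftrightarrow> (\<exists>K. \<forall>x\<in>vcarrier X. vnorm Y (T x) \<le> K * vnorm X x)"

definition op_norm :: "'v qspace \<Rightarrow> 'w qspace \<Rightarrow> ('v \<Rightarrow> 'w) \<Rightarrow> real" where
  "op_norm X Y T = (SUP x\<in>{x \<in> vcarrier X. vnorm X x \<le> 1}. vnorm Y (T x))"

definition isomorphisms :: "'v qspace \<Rightarrow> 'w qspace \<Rightarrow> ('v \<Rightarrow> 'w) set" where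
  "isomorphisms X Y =
     {T. linear_map X Y T \<and> bij_betw T (vcarrier X) (vcarrier Y) \<and>
         bounded_map X Y T \<and> bounded_map Y X (inv_into (vcarrier X) T)}"

text \<open>Extended real valued, so that the distance of non-isomorphic spaces is \<open>\<infinity>\<close>.\<close>

definition banach_mazur :: "'v qspace \<Rightarrow> 'w qspace \<Rightarrow> ereal" where
  "banach_mazur X Y =
     (INF T\<in>isomorphisms X Y. ereal (op_norm X Y T * op_norm Y X (inv_into (vcarrier X) T)))"

definition cauchy_seqs :: "'v qspace \<Rightarrow> (nat \<Rightarrow> 'v) set" where
  "cauchy_seqs X =
     {s. range s \<subseteq> vcarrier X \<and>
         (\<forall>e>0. \<exists>N. \<forall>m\<ge>N. \<forall>n\<ge>N. vnorm X (vdiff X (s m) (s n)) < e)}"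

definition null_rel :: "'v qspace \<Rightarrow> ((nat \<Rightarrow> 'v) \<times> (nat \<Rightarrow> 'v)) set" where
  "null_rel X =
     {(s, t). s \<in> cauchy_seqs X \<and> t \<in> cauchy_seqs X \<and>
              (\<lambda>n. vnorm X (vdiff X (s n) (t n))) \<longlonglongrightarrow> 0}"

definition completion :: "'v qspace \<Rightarrow> (nat \<Rightarrow> 'v) set qspace" where
  "completion X =
     \<lparr> vcarrier = cauchy_seqs X // null_rel X,
       vadd = (\<lambda>A B. \<Union>s\<in>A. \<Union>t\<in>B. null_rel X `` {\<lambda>n. vadd X (s n) (t n)}),
       vscale = (\<lambda>c A. \<Union>s\<in>A. null_rel X `` {\<lambda>n. vscale X c (s n)}),
       vnorm = (\<lambda>A. THE r. \<forall>s\<in>A. (\<lambda>n. vnorm X (s n)) \<longlonglongrightarrow> r) \<rparr>"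

text \<open>
  \<open>M\<close> is the underlying set, \<open>\<sigma>\<close> the metric and \<open>z\<close> the base point. The vector space with
  basis \<open>M - {z}\<close> is realised as the finitely supported functions vanishing off \<open>M - {z}\<close>.
\<close>

definition delta :: "'a \<Rightarrow> 'a \<Rightarrow> 'a \<Rightarrow> real" where
  "delta z x = (if x = z then (\<lambda>t. 0) else (\<lambda>t. if t = x then 1 else 0))"

definition free_norm ::
  "real \<Rightarrow> 'a set \<Rightarrow> ('a \<Rightarrow> 'a \<Rightarrow> real) \<Rightarrow> 'a \<Rightarrow> ('a \<Rightarrow> real) \<Rightarrow> real" where
  "free_norm p M \<sigma> z m =
     Inf {(\<Sum>i<n. \<bar>a i\<bar> powr p) powr (1 / p) | (n::nat) a x y.
            (\<forall>i<n. x i \<in> M \<and> y i \<in> M \<and> x i \<noteq> y i) \<and>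
            m = (\<lambda>t. \<Sum>i<n. a i * ((delta z (x i) t - delta z (y i) t) / \<sigma> (x i) (y i)))}"

definition free_pre_space ::
  "real \<Rightarrow> 'a set \<Rightarrow> ('a \<Rightarrow> 'a \<Rightarrow> real) \<Rightarrow> 'a \<Rightarrow> ('a \<Rightarrow> real) qspace" where
  "free_pre_space p M \<sigma> z =
     \<lparr> vcarrier = {m. finite {t. m t \<noteq> 0} \<and> {t. m t \<noteq> 0} \<subseteq> M - {z}},
       vadd = (\<lambda>f g t. f t + g t),
       vscale = (\<lambda>c f t. c * f t),
       vnorm = free_norm p M \<sigma> z \<rparr>"

definition lipschitz_free_space ::
  "real \<Rightarrow> 'a set \<Rightarrow> ('a \<Rightarrow> 'a \<Rightarrow> real) \<Rightarrow> 'a \<Rightarrow> (nat \<Rightarrow> 'a \<Rightarrow> real) set qspace" where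
  "lipschitz_free_space p M \<sigma> z = completion (free_pre_space p M \<sigma> z)"

text \<open>Families indexed by \<open>V\<close> are extended by 0 to the whole type.\<close>

definition lp_space :: "real \<Rightarrow> 'b set \<Rightarrow> ('b \<Rightarrow> real) qspace" where
  "lp_space p V =
     \<lparr> vcarrier = {a. (\<forall>v. v \<notin> V \<longrightarrow> a v = 0) \<and> (\<lambda>v. \<bar>a v\<bar> powr p) summable_on V},
       vadd = (\<lambda>f g t. f t + g t),
       vscale = (\<lambda>c f t. c * f t),
       vnorm = (\<lambda>a. (\<Sum>\<^sub>\<infinity>v\<in>V. \<bar>a v\<bar> powr p) powr (1 / p)) \<rparr>"

definition l1_norm :: "real ^ 'd \<Rightarrow> real" where
  "l1_norm x = (\<Sum>i\<in>UNIV. \<bar>x $ i\<bar>)"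

definition dyadic_points :: "(real ^ 'd) set" where
  "dyadic_points = (\<Union>k::nat. cbox 0 1 \<inter> {x. \<forall>i. \<exists>j::int. x $ i = of_int j / 2 ^ k}) - {0}"

definition Cconst :: "real \<Rightarrow> nat \<Rightarrow> real" where
  "Cconst q n = real n powr (1 / q - 1)"

definition rho :: "real \<Rightarrow> real \<Rightarrow> real" where
  "rho p \<alpha> =
     (Cconst p 2 powr p
      + (1 + 2 powr (1 - p)) * 2 powr (- p * \<alpha>) * (1 / (1 - 2 powr (- p * \<alpha>)))) powr (1 / p)"

definition tau :: "nat \<Rightarrow> real \<Rightarrow> real \<Rightarrow> real" where
  "tau d p \<alpha> =
     Cconst (p * \<alpha>) d powr \<alpha> * 2 powr (2 / p)
     * (1 / (1 - 2 powr (p * (\<alpha> - 1)))) powr (1 / p)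
     * (1 / (1 - 2 powr (- p * \<alpha>))) powr (1 / p)
     * (1 + (real d - 1) powr (p * \<alpha>)) powr (1 / p)"

end

theory Submission
  imports Defs "HOL-Library.Function_Algebras"
begin

text \<open>
  Expand in a hierarchical (Faber--Schauder) basis. For \<open>v\<close> first appearing in the dyadic grid of level
  \<open>k\<close>, let \<open>hat v\<close> be the product of tent functions of half-width \<open>2^-k\<close> at \<open>v\<close>, and let \<open>e_v\<close> be \<open>\<delta>(v)\<close>
  minus the average of \<open>\<delta>\<close> over the corners of the coarser grid cell face centred at \<open>v\<close>. These are
  biorthogonal, because \<open>hat u\<close> is reproduced by multilinear interpolation on all finer grids.
  The map sending \<open>m\<close> to the family \<open>2^(-\<alpha>k) <hat v, m>\<close> is bounded: at level \<open>k\<close> at most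
  \<open>2 * 2^d\<close> hats see a given molecule, each of them is \<open>2^k\<close>-Lipschitz with values in \<open>[0,1]\<close>, and
  the resulting sum over \<open>k\<close> is a two-sided geometric series.
  Its inverse is bounded because \<open>e_v\<close> is a mean of \<open>2^d\<close> differences \<open>\<delta>(v) - \<delta>(w)\<close> with
  \<open>|v - w| \<le> d 2^-k\<close>. The range is dense, so the map extends to an isomorphism of the completion.
\<close>

section \<open>Completions of p-normed function spaces\<close>

text \<open>For p < 1 only the p-th power of the norm is subadditive, so estimates are made for p-th
  powers and roots are taken when passing to operator norms. Averaging is then not free: a mean of
  2^d vectors of norm at most s has norm at most (2^d)^(1/p - 1) * s, and this is where C(p,2^d)
  enters. The other bound rests on \<alpha> lying strictly between 0 and 1: for two points at
  distance t, the levels with 2^k t \<le> 1 are controlled by the Lipschitz estimate and sum up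
  because \<alpha> < 1, the finer levels by boundedness of the hats and sum up because \<alpha> > 0.
  The obstacle is that finite combinations of the e_v are supported on dyadic points, while the
  lower estimate is needed for every finitely supported function on the cube. It is proved for those
  combinations and carried over by rounding the support to finer and finer grids, where the upper
  estimate controls the coefficients of the rounding error. The bounds obtained this way do not have
  the shape of the stated constant; the comparison is a separate elementary inequality.\<close>

locale pnormed_fun_space =
  fixes X :: "('a \<Rightarrow> real) qspace" and p :: real
  assumes p_pos: "0 < p"
    and vadd_eq: "vadd X = (\<lambda>f g t. f t + g t)"
    and vscale_eq: "vscale X = (\<lambda>c f t. c * f t)"
    and zero_closed: "0 \<in> vcarrier X"
    and add_closed: "x \<in> vcarrier X \<Longrightarrow> y \<in> vcarrier X \<Longrightarrow> x + y \<in> vcarrier X"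
    and scale_closed: "x \<in> vcarrier X \<Longrightarrow> (\<lambda>t. c * x t) \<in> vcarrier X"
    and norm_nonneg: "x \<in> vcarrier X \<Longrightarrow> 0 \<le> vnorm X x"
    and norm_scale: "x \<in> vcarrier X \<Longrightarrow> vnorm X (\<lambda>t. c * x t) = \<bar>c\<bar> * vnorm X x"
    and norm_add: "x \<in> vcarrier X \<Longrightarrow> y \<in> vcarrier X \<Longrightarrow>
      vnorm X (x + y) powr p \<le> vnorm X x powr p + vnorm X y powr p"
begin

lemma vadd_plus: "vadd X x y = x + y"
  by (simp add: vadd_eq plus_fun_def)

lemma vscale_apply: "vscale X c x = (\<lambda>t. c * x t)"
  by (simp add: vscale_eq)

lemma vdiff_minus: "vdiff X x y = x - y"
  by (simp add: vdiff_def vadd_eq vscale_eq fun_diff_def)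

lemma uminus_closed: "x \<in> vcarrier X \<Longrightarrow> - x \<in> vcarrier X"
  using scale_closed[of x "-1"] by (simp add: fun_Compl_def)

lemma diff_closed: "x \<in> vcarrier X \<Longrightarrow> y \<in> vcarrier X \<Longrightarrow> x - y \<in> vcarrier X"
  using add_closed[of x "- y"] uminus_closed[of y] by simp

lemma norm_uminus: "x \<in> vcarrier X \<Longrightarrow> vnorm X (- x) = vnorm X x"
  using norm_scale[of x "-1"] by (simp add: fun_Compl_def)

lemma norm_minus_commute:
  "x \<in> vcarrier X \<Longrightarrow> y \<in> vcarrier X \<Longrightarrow> vnorm X (x - y) = vnorm X (y - x)"
  using norm_uminus[of "y - x"] diff_closed[of y x] by simp

lemma norm_zero: "vnorm X 0 = 0"
  using norm_scale[OF zero_closed, of 0] by (simp add: zero_fun_def)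

lemma norm_triangle:
  assumes "x \<in> vcarrier X" "y \<in> vcarrier X" "z \<in> vcarrier X"
  shows "vnorm X (x - z) powr p \<le> vnorm X (x - y) powr p + vnorm X (y - z) powr p"
  using norm_add[OF diff_closed[OF assms(1,2)] diff_closed[OF assms(2,3)]] by simp

lemma norm_powr_diff_le:
  assumes "x \<in> vcarrier X" "y \<in> vcarrier X"
  shows "\<bar>vnorm X x powr p - vnorm X y powr p\<bar> \<le> vnorm X (x - y) powr p"
  using norm_triangle[OF assms zero_closed] norm_triangle[OF assms(2,1) zero_closed]
    norm_minus_commute[OF assms] by simp

text \<open>On nonnegative reals t -> t^p is a homeomorphism because p > 0, so limits can be
  computed where the triangle inequality is available.\<close>

lemma norm_powr_tendsto:
  assumes "\<And>n. s n \<in> vcarrier X" "0 \<le> r"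
  shows "(\<lambda>n. vnorm X (s n)) \<longlonglongrightarrow> r \<longleftrightarrow> (\<lambda>n. vnorm X (s n) powr p) \<longlonglongrightarrow> r powr p"
proof
  assume "(\<lambda>n. vnorm X (s n)) \<longlonglongrightarrow> r"
  then show "(\<lambda>n. vnorm X (s n) powr p) \<longlonglongrightarrow> r powr p"
    using p_pos assms norm_nonneg by (intro tendsto_powr2 always_eventually) auto
next
  assume *: "(\<lambda>n. vnorm X (s n) powr p) \<longlonglongrightarrow> r powr p"
  have "(\<lambda>n. (vnorm X (s n) powr p) powr (1/p)) \<longlonglongrightarrow> (r powr p) powr (1/p)"
    using p_pos assms * by (intro tendsto_powr2[OF *] always_eventually) auto
  then show "(\<lambda>n. vnorm X (s n)) \<longlonglongrightarrow> r"
    using p_pos assms norm_nonneg by (simp add: powr_powr)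
qed

lemma norm_powr_tendsto_0:
  assumes "\<And>n. s n \<in> vcarrier X"
  shows "(\<lambda>n. vnorm X (s n)) \<longlonglongrightarrow> 0 \<longleftrightarrow> (\<lambda>n. vnorm X (s n) powr p) \<longlonglongrightarrow> 0"
  using norm_powr_tendsto[OF assms, of 0] p_pos by simp

lemma norm_tendsto_0_add:
  assumes "\<And>n. s n \<in> vcarrier X" "\<And>n. t n \<in> vcarrier X"
    and "(\<lambda>n. vnorm X (s n)) \<longlonglongrightarrow> 0" "(\<lambda>n. vnorm X (t n)) \<longlonglongrightarrow> 0"
  shows "(\<lambda>n. vnorm X (s n + t n)) \<longlonglongrightarrow> 0"
proof -
  have "(\<lambda>n. vnorm X (s n) powr p + vnorm X (t n) powr p) \<longlonglongrightarrow> 0 + 0"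
    using assms by (intro tendsto_add) (simp_all add: norm_powr_tendsto_0)
  then have "(\<lambda>n. vnorm X (s n) powr p + vnorm X (t n) powr p) \<longlonglongrightarrow> 0" by simp
  then have "(\<lambda>n. vnorm X (s n + t n) powr p) \<longlonglongrightarrow> 0"
    by (rule Lim_null_comparison[rotated]) (use assms norm_add in auto)
  then show ?thesis using assms add_closed by (simp add: norm_powr_tendsto_0)
qed

lemma norm_tendsto_0_minus:
  assumes "\<And>n. s n \<in> vcarrier X" "\<And>n. t n \<in> vcarrier X"
    and "(\<lambda>n. vnorm X (s n)) \<longlonglongrightarrow> 0" "(\<lambda>n. vnorm X (t n)) \<longlonglongrightarrow> 0"
  shows "(\<lambda>n. vnorm X (s n - t n)) \<longlonglongrightarrow> 0"
  using norm_tendsto_0_add[of s "\<lambda>n. - t n"] assms uminus_closed norm_uminus by simp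

lemma tendsto_norm:
  assumes "\<And>n. s n \<in> vcarrier X" "x \<in> vcarrier X" "(\<lambda>n. vnorm X (s n - x)) \<longlonglongrightarrow> 0"
  shows "(\<lambda>n. vnorm X (s n)) \<longlonglongrightarrow> vnorm X x"
proof -
  have "(\<lambda>n. vnorm X (s n - x) powr p) \<longlonglongrightarrow> 0"
    using assms diff_closed by (simp add: norm_powr_tendsto_0)
  then have "(\<lambda>n. vnorm X (s n) powr p - vnorm X x powr p) \<longlonglongrightarrow> 0"
    by (rule Lim_null_comparison[rotated]) (use assms norm_powr_diff_le in auto)
  then have "(\<lambda>n. vnorm X (s n) powr p) \<longlonglongrightarrow> vnorm X x powr p"
    by (simp add: LIM_zero_iff)
  then show ?thesis using assms norm_nonneg by (simp add: norm_powr_tendsto)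
qed

text \<open>Replacing a threshold e by e^p turns the Cauchy condition into one for the subadditive
  p-th powers.\<close>

lemma cauchy_seqs_iff:
  "s \<in> cauchy_seqs X \<longleftrightarrow> (\<forall>n. s n \<in> vcarrier X) \<and>
     (\<forall>e>0. \<exists>N. \<forall>m\<ge>N. \<forall>n\<ge>N. vnorm X (s m - s n) powr p < e)"
proof (cases "\<forall>n. s n \<in> vcarrier X")
  case True
  have eq: "vnorm X (s m - s n) < e \<longleftrightarrow> vnorm X (s m - s n) powr p < e powr p" if "e > 0" for e m n
    using True diff_closed norm_nonneg p_pos that
    by (metis linorder_not_less powr_less_mono2 powr_mono2 order_less_imp_le)
  have "(\<forall>e>0. \<exists>N. \<forall>m\<ge>N. \<forall>n\<ge>N. vnorm X (s m - s n) < e) \<longleftrightarrow>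
        (\<forall>e>0. \<exists>N. \<forall>m\<ge>N. \<forall>n\<ge>N. vnorm X (s m - s n) powr p < e)"
  proof (intro iffI allI impI)
    fix e :: real
    assume "\<forall>e>0. \<exists>N. \<forall>m\<ge>N. \<forall>n\<ge>N. vnorm X (s m - s n) < e" "e > 0"
    then have "\<exists>N. \<forall>m\<ge>N. \<forall>n\<ge>N. vnorm X (s m - s n) < e powr (1/p)" by simp
    then show "\<exists>N. \<forall>m\<ge>N. \<forall>n\<ge>N. vnorm X (s m - s n) powr p < e"
      using p_pos \<open>e > 0\<close> by (subst (asm) eq) (auto simp: powr_powr)
  next
    fix e :: real
    assume "\<forall>e>0. \<exists>N. \<forall>m\<ge>N. \<forall>n\<ge>N. vnorm X (s m - s n) powr p < e" "e > 0"
    then show "\<exists>N. \<forall>m\<ge>N. \<forall>n\<ge>N. vnorm X (s m - s n) < e"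
      by (simp add: eq)
  qed
  then show ?thesis using True by (auto simp: cauchy_seqs_def vdiff_minus)
qed (auto simp: cauchy_seqs_def)

lemma cauchy_seqs_closed: "s \<in> cauchy_seqs X \<Longrightarrow> s n \<in> vcarrier X"
  by (simp add: cauchy_seqs_iff)

lemma null_rel_iff: "(s, t) \<in> null_rel X \<longleftrightarrow>
    s \<in> cauchy_seqs X \<and> t \<in> cauchy_seqs X \<and> (\<lambda>n. vnorm X (s n - t n)) \<longlonglongrightarrow> 0"
  by (simp add: null_rel_def vdiff_minus)

lemma cauchy_seqs_add:
  assumes "s \<in> cauchy_seqs X" "t \<in> cauchy_seqs X"
  shows "(\<lambda>n. s n + t n) \<in> cauchy_seqs X"
  unfolding cauchy_seqs_iff
proof safe
  fix n show "s n + t n \<in> vcarrier X" using assms by (simp add: cauchy_seqs_closed add_closed)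
next
  fix e :: real assume "e > 0"
  then obtain N M where
    N: "\<And>m n. m \<ge> N \<Longrightarrow> n \<ge> N \<Longrightarrow> vnorm X (s m - s n) powr p < e / 2" and
    M: "\<And>m n. m \<ge> M \<Longrightarrow> n \<ge> M \<Longrightarrow> vnorm X (t m - t n) powr p < e / 2"
    using assms unfolding cauchy_seqs_iff by (meson half_gt_zero)
  have "vnorm X (s m + t m - (s n + t n)) powr p < e" if "m \<ge> max N M" "n \<ge> max N M" for m n
    using N[of m n] M[of m n] that assms
      norm_add[of "s m - s n" "t m - t n"] cauchy_seqs_closed diff_closed
    by (simp add: algebra_simps)
  then show "\<exists>N. \<forall>m\<ge>N. \<forall>n\<ge>N. vnorm X (s m + t m - (s n + t n)) powr p < e" by blast
qed

lemma cauchy_seqs_scale: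
  assumes "s \<in> cauchy_seqs X"
  shows "(\<lambda>n t. c * s n t) \<in> cauchy_seqs X"
  unfolding cauchy_seqs_iff
proof safe
  fix n show "(\<lambda>t. c * s n t) \<in> vcarrier X" using assms by (simp add: cauchy_seqs_closed scale_closed)
next
  fix e :: real assume "e > 0"
  \<comment> \<open>The summand 1 keeps the divisor positive when c = 0.\<close>
  define K where "K = \<bar>c\<bar> powr p + 1"
  have K: "K > 0" by (simp add: K_def add_nonneg_pos)
  with \<open>e > 0\<close> obtain N where
    N: "\<And>m n. m \<ge> N \<Longrightarrow> n \<ge> N \<Longrightarrow> vnorm X (s m - s n) powr p < e / K"
    using assms unfolding cauchy_seqs_iff by (meson divide_pos_pos)
  have "vnorm X ((\<lambda>t. c * s m t) - (\<lambda>t. c * s n t)) powr p < e" if "m \<ge> N" "n \<ge> N" for m n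
  proof -
    have "(\<lambda>t. c * s m t) - (\<lambda>t. c * s n t) = (\<lambda>t. c * (s m - s n) t)"
      by (simp add: fun_eq_iff algebra_simps)
    then have "vnorm X ((\<lambda>t. c * s m t) - (\<lambda>t. c * s n t)) = \<bar>c\<bar> * vnorm X (s m - s n)"
      using assms by (simp add: cauchy_seqs_closed diff_closed norm_scale del: minus_apply)
    then have "vnorm X ((\<lambda>t. c * s m t) - (\<lambda>t. c * s n t)) powr p
        = \<bar>c\<bar> powr p * vnorm X (s m - s n) powr p"
      using assms by (simp add: powr_mult cauchy_seqs_closed diff_closed norm_nonneg)
    also have "\<dots> \<le> K * vnorm X (s m - s n) powr p" by (simp add: K_def mult_right_mono)
    also have "\<dots> < e" using N[OF that] K by (simp add: field_simps)
    finally show ?thesis .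
  qed
  then show "\<exists>N. \<forall>m\<ge>N. \<forall>n\<ge>N. vnorm X ((\<lambda>t. c * s m t) - (\<lambda>t. c * s n t)) powr p < e" by blast
qed

lemma equiv_null_rel: "equiv (cauchy_seqs X) (null_rel X)"
proof (rule equivI)
  show "null_rel X \<subseteq> cauchy_seqs X \<times> cauchy_seqs X" by (auto simp: null_rel_iff)
  show "refl_on (cauchy_seqs X) (null_rel X)"
    by (auto simp: refl_on_def null_rel_iff norm_zero)
  show "sym (null_rel X)"
    using norm_minus_commute by (auto simp: sym_def null_rel_iff cauchy_seqs_closed)
  show "trans (null_rel X)"
  proof (rule transI)
    fix s t u assume *: "(s, t) \<in> null_rel X" "(t, u) \<in> null_rel X"
    then have "(\<lambda>n. vnorm X ((s n - t n) + (t n - u n))) \<longlonglongrightarrow> 0"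
      by (intro norm_tendsto_0_add[of "\<lambda>n. s n - t n" "\<lambda>n. t n - u n"]) (auto simp: null_rel_iff cauchy_seqs_closed diff_closed)
    then show "(s, u) \<in> null_rel X" using * by (simp add: null_rel_iff)
  qed
qed

lemma const_cauchy_seqs: "x \<in> vcarrier X \<Longrightarrow> (\<lambda>_. x) \<in> cauchy_seqs X"
  by (simp add: cauchy_seqs_iff norm_zero)

section \<open>Operations and norm on classes of Cauchy sequences\<close>

lemma completion_carrierE:
  assumes "A \<in> vcarrier (completion X)"
  obtains s where "s \<in> cauchy_seqs X" "A = null_rel X `` {s}"
  using assms unfolding completion_def by (auto elim!: quotientE)

lemma class_in_completion: "s \<in> cauchy_seqs X \<Longrightarrow> null_rel X `` {s} \<in> vcarrier (completion X)"
  by (simp add: completion_def quotientI)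

lemma null_rel_refl: "s \<in> cauchy_seqs X \<Longrightarrow> s \<in> null_rel X `` {s}"
  using equiv_class_self[OF equiv_null_rel] .

lemma class_eq_iff:
  "s \<in> cauchy_seqs X \<Longrightarrow> t \<in> cauchy_seqs X \<Longrightarrow>
    null_rel X `` {s} = null_rel X `` {t} \<longleftrightarrow> (\<lambda>n. vnorm X (s n - t n)) \<longlonglongrightarrow> 0"
  by (simp add: eq_equiv_class_iff[OF equiv_null_rel] null_rel_iff)

text \<open>The sum of two classes is defined as a union over all pairs of representatives. Each
  member of that union is the same class, and the union is non-empty because every sequence
  represents its own class.\<close>

lemma completion_add:
  assumes "s \<in> cauchy_seqs X" "t \<in> cauchy_seqs X"
  shows "vadd (completion X) (null_rel X `` {s}) (null_rel X `` {t}) = null_rel X `` {\<lambda>n. s n + t n}"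
proof -
  have "null_rel X `` {\<lambda>n. vadd X (s' n) (t' n)} = null_rel X `` {\<lambda>n. s n + t n}"
    if "s' \<in> null_rel X `` {s}" "t' \<in> null_rel X `` {t}" for s' t'
  proof -
    have *: "s' \<in> cauchy_seqs X" "t' \<in> cauchy_seqs X" "(\<lambda>n. vnorm X (s n - s' n)) \<longlonglongrightarrow> 0"
      "(\<lambda>n. vnorm X (t n - t' n)) \<longlonglongrightarrow> 0"
      using that by (auto simp: null_rel_iff)
    then have "(\<lambda>n. vnorm X ((s n - s' n) + (t n - t' n))) \<longlonglongrightarrow> 0"
      using assms by (intro norm_tendsto_0_add[of "\<lambda>n. s n - s' n" "\<lambda>n. t n - t' n"]) (auto simp: cauchy_seqs_closed diff_closed)
    then have "null_rel X `` {\<lambda>n. s n + t n} = null_rel X `` {\<lambda>n. s' n + t' n}"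
      using assms * by (subst class_eq_iff) (auto intro: cauchy_seqs_add simp: algebra_simps)
    then show ?thesis by (simp add: vadd_plus)
  qed
  then have "(\<Union>s'\<in>null_rel X `` {s}. \<Union>t'\<in>null_rel X `` {t}. null_rel X `` {\<lambda>n. vadd X (s' n) (t' n)})
      = (\<Union>s'\<in>null_rel X `` {s}. \<Union>t'\<in>null_rel X `` {t}. null_rel X `` {\<lambda>n. s n + t n})"
    by (intro SUP_cong refl) auto
  also have "\<dots> = null_rel X `` {\<lambda>n. s n + t n}"
    using null_rel_refl[OF assms(1)] null_rel_refl[OF assms(2)] by blast
  finally show ?thesis by (simp add: completion_def)
qed

lemma completion_scale:
  assumes "s \<in> cauchy_seqs X"
  shows "vscale (completion X) c (null_rel X `` {s}) = null_rel X `` {\<lambda>n t. c * s n t}"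
proof -
  have "null_rel X `` {\<lambda>n. vscale X c (s' n)} = null_rel X `` {\<lambda>n t. c * s n t}"
    if "s' \<in> null_rel X `` {s}" for s'
  proof -
    have *: "s' \<in> cauchy_seqs X" "(\<lambda>n. vnorm X (s n - s' n)) \<longlonglongrightarrow> 0"
      using that by (auto simp: null_rel_iff)
    have eq: "vnorm X ((\<lambda>t. c * s n t) - (\<lambda>t. c * s' n t)) = \<bar>c\<bar> * vnorm X (s n - s' n)" for n
    proof -
      have "(\<lambda>t. c * s n t) - (\<lambda>t. c * s' n t) = (\<lambda>t. c * (s n - s' n) t)"
        by (simp add: fun_eq_iff algebra_simps)
      then show ?thesis using assms *
        by (simp add: cauchy_seqs_closed diff_closed norm_scale del: minus_apply)
    qed
    have "null_rel X `` {\<lambda>n t. c * s n t} = null_rel X `` {\<lambda>n t. c * s' n t}"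
      using assms * tendsto_mult_right_zero[OF *(2), of "\<bar>c\<bar>"]
      by (subst class_eq_iff) (auto intro: cauchy_seqs_scale simp: eq)
    then show ?thesis by (simp add: vscale_apply)
  qed
  then have "(\<Union>s'\<in>null_rel X `` {s}. null_rel X `` {\<lambda>n. vscale X c (s' n)})
      = (\<Union>s'\<in>null_rel X `` {s}. null_rel X `` {\<lambda>n t. c * s n t})"
    by (intro SUP_cong refl) auto
  also have "\<dots> = null_rel X `` {\<lambda>n t. c * s n t}"
    using null_rel_refl[OF assms] by blast
  finally show ?thesis by (simp add: completion_def)
qed

text \<open>Discharges the definite description in the norm of the completion: the p-th powers of
  the norms form a real Cauchy sequence, equivalent representatives share its limit, and real limits
  are unique.\<close>

lemma completion_norm:
  assumes "s \<in> cauchy_seqs X"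
  shows "(\<lambda>n. vnorm X (s n)) \<longlonglongrightarrow> vnorm (completion X) (null_rel X `` {s})"
proof -
  have "Cauchy (\<lambda>n. vnorm X (s n) powr p)"
  proof (rule metric_CauchyI)
    fix e :: real assume "e > 0"
    then obtain N where N: "\<And>m n. m \<ge> N \<Longrightarrow> n \<ge> N \<Longrightarrow> vnorm X (s m - s n) powr p < e"
      using assms unfolding cauchy_seqs_iff by meson
    have "dist (vnorm X (s m) powr p) (vnorm X (s n) powr p) < e" if "m \<ge> N" "n \<ge> N" for m n
      using N[OF that] norm_powr_diff_le[of "s m" "s n"] assms
      by (simp add: dist_real_def cauchy_seqs_closed)
    then show "\<exists>N. \<forall>m\<ge>N. \<forall>n\<ge>N. dist (vnorm X (s m) powr p) (vnorm X (s n) powr p) < e" by blast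
  qed
  then obtain q where q: "(\<lambda>n. vnorm X (s n) powr p) \<longlonglongrightarrow> q"
    using Cauchy_convergent_iff convergent_def by blast
  define r where "r = q powr (1/p)"
  have "0 \<le> q" by (rule LIMSEQ_le_const[OF q]) simp
  then have "q = r powr p" using p_pos by (simp add: r_def powr_powr)
  have "0 \<le> r" by (simp add: r_def)
  have r: "(\<lambda>n. vnorm X (s n)) \<longlonglongrightarrow> r"
    using assms q \<open>0 \<le> r\<close> unfolding \<open>q = r powr p\<close>
    by (subst norm_powr_tendsto) (auto simp: cauchy_seqs_closed)
  have all: "(\<lambda>n. vnorm X (t n)) \<longlonglongrightarrow> r" if "t \<in> null_rel X `` {s}" for t
  proof -
    have *: "t \<in> cauchy_seqs X" "(\<lambda>n. vnorm X (s n - t n)) \<longlonglongrightarrow> 0"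
      using that by (auto simp: null_rel_iff)
    then have "(\<lambda>n. vnorm X (s n - t n) powr p) \<longlonglongrightarrow> 0"
      using assms by (subst (asm) norm_powr_tendsto_0) (auto simp: cauchy_seqs_closed diff_closed)
    then have "(\<lambda>n. vnorm X (s n) powr p - vnorm X (t n) powr p) \<longlonglongrightarrow> 0"
      by (rule Lim_null_comparison[rotated])
        (use assms * norm_powr_diff_le in \<open>auto simp: cauchy_seqs_closed\<close>)
    then have "(\<lambda>n. vnorm X (s n) powr p - (vnorm X (s n) powr p - vnorm X (t n) powr p)) \<longlonglongrightarrow> q - 0"
      by (intro tendsto_diff q)
    then show ?thesis using * \<open>0 \<le> r\<close> unfolding \<open>q = r powr p\<close>
      by (subst norm_powr_tendsto) (auto simp: cauchy_seqs_closed)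
  qed
  have "(THE r. \<forall>t\<in>null_rel X `` {s}. (\<lambda>n. vnorm X (t n)) \<longlonglongrightarrow> r) = r"
  proof (rule the_equality)
    show "\<forall>t\<in>null_rel X `` {s}. (\<lambda>n. vnorm X (t n)) \<longlonglongrightarrow> r" using all by blast
    fix r' assume "\<forall>t\<in>null_rel X `` {s}. (\<lambda>n. vnorm X (t n)) \<longlonglongrightarrow> r'"
    then have "(\<lambda>n. vnorm X (s n)) \<longlonglongrightarrow> r'" using null_rel_refl[OF assms] by blast
    then show "r' = r" using r LIMSEQ_unique by blast
  qed
  then show ?thesis using r by (simp add: completion_def)
qed

end

text \<open>Reduces the distance to two estimates on the uncompleted space, where \<open>T\<close>
  need not be onto. The upper estimate extends \<open>T\<close> by continuity to the completion. The
  lower one gives injectivity and pulls Cauchy sequences back, so that density of the range together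
  with completeness of \<open>Y\<close> gives surjectivity.\<close>

theorem banach_mazur_completion_le:
  fixes T :: "('a \<Rightarrow> real) \<Rightarrow> ('b \<Rightarrow> real)"
  assumes X: "pnormed_fun_space X p" and Y: "pnormed_fun_space Y p"
    and lin: "linear_map X Y T"
    and upper: "\<And>x. x \<in> vcarrier X \<Longrightarrow> vnorm Y (T x) \<le> C * vnorm X x"
    and lower: "\<And>x. x \<in> vcarrier X \<Longrightarrow> vnorm X x \<le> K * vnorm Y (T x)"
    and nonneg: "0 \<le> C" "0 \<le> K"
    and definite: "\<And>y. y \<in> vcarrier Y \<Longrightarrow> vnorm Y y = 0 \<Longrightarrow> y = 0"
    and complete: "\<And>s. s \<in> cauchy_seqs Y \<Longrightarrow>
      \<exists>y\<in>vcarrier Y. (\<lambda>n. vnorm Y (s n - y)) \<longlonglongrightarrow> 0"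
    and dense: "\<And>y e. y \<in> vcarrier Y \<Longrightarrow> 0 < e \<Longrightarrow> \<exists>x\<in>vcarrier X. vnorm Y (T x - y) < e"
  shows "banach_mazur (completion X) Y \<le> ereal (C * K)"
proof -
  interpret X: pnormed_fun_space X p by fact
  interpret Y: pnormed_fun_space Y p by fact
  let ?X = "completion X"
  have T_closed: "T x \<in> vcarrier Y" if "x \<in> vcarrier X" for x
    using lin that by (auto simp: linear_map_def)
  have T_add: "T (x + y) = T x + T y" if "x \<in> vcarrier X" "y \<in> vcarrier X" for x y
    using lin that by (auto simp: linear_map_def X.vadd_plus Y.vadd_plus)
  have T_scale: "T (\<lambda>t. c * x t) = (\<lambda>t. c * T x t)" if "x \<in> vcarrier X" for x c
    using lin that by (auto simp: linear_map_def X.vscale_apply Y.vscale_apply)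
  have T_diff: "T (x - y) = T x - T y" if "x \<in> vcarrier X" "y \<in> vcarrier X" for x y
    using T_add[of "x - y" y] X.diff_closed that by (simp add: eq_diff_eq)
  define lim where "lim s y \<longleftrightarrow> y \<in> vcarrier Y \<and> (\<lambda>n. vnorm Y (T (s n) - y)) \<longlonglongrightarrow> 0" for s y
  have lim_ex: "\<exists>y. lim s y" if s: "s \<in> cauchy_seqs X" for s
  proof -
    have "(\<lambda>n. T (s n)) \<in> cauchy_seqs Y"
      unfolding cauchy_seqs_def
    proof (safe; simp add: Y.vdiff_minus)
      fix n show "T (s n) \<in> vcarrier Y" using s by (simp add: T_closed X.cauchy_seqs_closed)
    next
      fix e :: real assume "e > 0"
      then have "e / (C + 1) > 0" using nonneg by simp
      then obtain N where N: "\<And>m n. m \<ge> N \<Longrightarrow> n \<ge> N \<Longrightarrow> vnorm X (s m - s n) < e / (C + 1)"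
        using s unfolding cauchy_seqs_def X.vdiff_minus mem_Collect_eq by meson
      have "vnorm Y (T (s m) - T (s n)) < e" if "m \<ge> N" "n \<ge> N" for m n
      proof -
        have sm: "s m \<in> vcarrier X" "s n \<in> vcarrier X" using s by (auto simp: X.cauchy_seqs_closed)
        have "vnorm Y (T (s m) - T (s n)) \<le> C * vnorm X (s m - s n)"
          using upper[OF X.diff_closed[OF sm]] T_diff[OF sm] by simp
        also have "\<dots> \<le> (C + 1) * vnorm X (s m - s n)"
          using X.norm_nonneg[OF X.diff_closed[OF sm]] by (simp add: mult_right_mono)
        also have "\<dots> < e" using N[OF that] nonneg by (simp add: field_simps)
        finally show ?thesis .
      qed
      then show "\<exists>N. \<forall>m\<ge>N. \<forall>n\<ge>N. vnorm Y (T (s m) - T (s n)) < e" by blast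
    qed
    from complete[OF this] show ?thesis by (auto simp: lim_def)
  qed
  \<comment> \<open>From right to left this makes the extension \<open>E\<close> well defined, by
    the upper estimate; from left to right it makes \<open>E\<close> injective, by the lower
    one.\<close>
  have lim_eq_iff: "y = z \<longleftrightarrow> null_rel X `` {s} = null_rel X `` {t}"
    if s: "s \<in> cauchy_seqs X" "lim s y" and t: "t \<in> cauchy_seqs X" "lim t z" for s t y z
  proof -
    have c: "s n \<in> vcarrier X" "t n \<in> vcarrier X" "T (s n) \<in> vcarrier Y" "T (t n) \<in> vcarrier Y"
      "y \<in> vcarrier Y" "z \<in> vcarrier Y" for n
      using s t by (auto simp: X.cauchy_seqs_closed T_closed lim_def)
    have l: "(\<lambda>n. vnorm Y (T (s n) - y)) \<longlonglongrightarrow> 0" "(\<lambda>n. vnorm Y (T (t n) - z)) \<longlonglongrightarrow> 0"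
      using s t by (auto simp: lim_def)
    have "(\<lambda>n. vnorm Y ((T (s n) - y) - (T (t n) - z))) \<longlonglongrightarrow> 0"
      using l c by (intro Y.norm_tendsto_0_minus[of "\<lambda>n. T (s n) - y" "\<lambda>n. T (t n) - z"]) (auto intro: Y.diff_closed)
    moreover have "(T (s n) - y) - (T (t n) - z) = T (s n - t n) - (y - z)" for n
      using c by (simp add: T_diff algebra_simps)
    ultimately have "(\<lambda>n. vnorm Y (T (s n - t n) - (y - z))) \<longlonglongrightarrow> 0" by simp
    then have L: "(\<lambda>n. vnorm Y (T (s n - t n))) \<longlonglongrightarrow> vnorm Y (y - z)"
      using c by (intro Y.tendsto_norm) (auto intro: Y.diff_closed X.diff_closed T_closed)
    show ?thesis
    proof
      assume "y = z"
      then have "(\<lambda>n. K * vnorm Y (T (s n - t n))) \<longlonglongrightarrow> 0"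
        using L by (intro tendsto_mult_right_zero) (simp add: Y.norm_zero)
      then have "(\<lambda>n. vnorm X (s n - t n)) \<longlonglongrightarrow> 0"
        by (rule Lim_null_comparison[rotated])
          (use c lower X.norm_nonneg in \<open>auto simp: X.diff_closed\<close>)
      then show "null_rel X `` {s} = null_rel X `` {t}" using s t by (simp add: X.class_eq_iff)
    next
      assume "null_rel X `` {s} = null_rel X `` {t}"
      then have "(\<lambda>n. vnorm X (s n - t n)) \<longlonglongrightarrow> 0" using s t by (simp add: X.class_eq_iff)
      then have "(\<lambda>n. C * vnorm X (s n - t n)) \<longlonglongrightarrow> 0" by (rule tendsto_mult_right_zero)
      then have "(\<lambda>n. vnorm Y (T (s n - t n))) \<longlonglongrightarrow> 0"
        by (rule Lim_null_comparison[rotated])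
          (use c upper Y.norm_nonneg in \<open>auto simp: X.diff_closed T_closed\<close>)
      then have "vnorm Y (y - z) = 0" using L LIMSEQ_unique by blast
      then have "y - z = 0" using c by (intro definite) (auto intro: Y.diff_closed)
      then show "y = z" by simp
    qed
  qed
  define E where "E A = (THE y. \<exists>s\<in>cauchy_seqs X. A = null_rel X `` {s} \<and> lim s y)" for A
  have E_eq: "E (null_rel X `` {s}) = y" if "s \<in> cauchy_seqs X" "lim s y" for s y
    unfolding E_def using that lim_eq_iff by (intro the_equality) blast+
  have E_lim: "lim s (E (null_rel X `` {s}))" if "s \<in> cauchy_seqs X" for s
    using lim_ex[OF that] E_eq[OF that] by auto
  have E_closed: "E A \<in> vcarrier Y" if "A \<in> vcarrier ?X" for A
    using that by (rule X.completion_carrierE) (use E_lim in \<open>auto simp: lim_def\<close>)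
  have E_norm: "(\<lambda>n. vnorm Y (T (s n))) \<longlonglongrightarrow> vnorm Y (E (null_rel X `` {s}))"
    if "s \<in> cauchy_seqs X" for s
    using E_lim[OF that] that by (intro Y.tendsto_norm) (auto simp: lim_def T_closed X.cauchy_seqs_closed)
  have E_upper: "vnorm Y (E A) \<le> C * vnorm ?X A" if A: "A \<in> vcarrier ?X" for A
    using A
  proof (rule X.completion_carrierE)
    fix s assume s: "s \<in> cauchy_seqs X" "A = null_rel X `` {s}"
    show ?thesis unfolding s(2)
      using E_norm[OF s(1)] tendsto_mult_left[OF X.completion_norm[OF s(1)], of C]
      by (rule LIMSEQ_le) (use s upper in \<open>auto simp: X.cauchy_seqs_closed\<close>)
  qed
  have E_lower: "vnorm ?X A \<le> K * vnorm Y (E A)" if A: "A \<in> vcarrier ?X" for A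
    using A
  proof (rule X.completion_carrierE)
    fix s assume s: "s \<in> cauchy_seqs X" "A = null_rel X `` {s}"
    show ?thesis unfolding s(2)
      using X.completion_norm[OF s(1)] tendsto_mult_left[OF E_norm[OF s(1)], of K]
      by (rule LIMSEQ_le) (use s lower in \<open>auto simp: X.cauchy_seqs_closed\<close>)
  qed
  have norm_nonneg: "0 \<le> vnorm ?X A" if A: "A \<in> vcarrier ?X" for A
    using A
  proof (rule X.completion_carrierE)
    fix s assume s: "s \<in> cauchy_seqs X" "A = null_rel X `` {s}"
    show ?thesis unfolding s(2)
      using X.completion_norm[OF s(1)]
      by (rule LIMSEQ_le_const) (use s X.norm_nonneg in \<open>auto simp: X.cauchy_seqs_closed\<close>)
  qed
  have E_linear: "linear_map ?X Y E"
    unfolding linear_map_def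
  proof safe
    fix A assume "A \<in> vcarrier ?X" then show "E A \<in> vcarrier Y" by (rule E_closed)
  next
    fix A B assume "A \<in> vcarrier ?X" "B \<in> vcarrier ?X"
    then obtain s t where s: "s \<in> cauchy_seqs X" "A = null_rel X `` {s}"
      and t: "t \<in> cauchy_seqs X" "B = null_rel X `` {t}"
      by (elim X.completion_carrierE)
    have ls: "lim s (E A)" and lt: "lim t (E B)" using E_lim s t by auto
    have "(\<lambda>n. vnorm Y ((T (s n) - E A) + (T (t n) - E B))) \<longlonglongrightarrow> 0"
      using ls lt s(1) t(1) by (intro Y.norm_tendsto_0_add[of "\<lambda>n. T (s n) - E A" "\<lambda>n. T (t n) - E B"])
        (auto simp: lim_def T_closed X.cauchy_seqs_closed Y.diff_closed)
    moreover have "(T (s n) - E A) + (T (t n) - E B) = T (s n + t n) - (E A + E B)" for n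
      using s(1) t(1) by (simp add: T_add X.cauchy_seqs_closed algebra_simps)
    ultimately have "lim (\<lambda>n. s n + t n) (E A + E B)"
      using ls lt by (simp add: lim_def Y.add_closed)
    then show "E (vadd ?X A B) = vadd Y (E A) (E B)"
      unfolding s(2) t(2) X.completion_add[OF s(1) t(1)] Y.vadd_plus
      by (intro E_eq X.cauchy_seqs_add s t) (simp add: s t)
  next
    fix c A assume "A \<in> vcarrier ?X"
    then obtain s where s: "s \<in> cauchy_seqs X" "A = null_rel X `` {s}"
      by (elim X.completion_carrierE)
    have ls: "lim s (E A)" using E_lim s by auto
    have "vnorm Y (T (\<lambda>t. c * s n t) - (\<lambda>t. c * E A t)) = \<bar>c\<bar> * vnorm Y (T (s n) - E A)" for n
    proof -
      have "T (\<lambda>t. c * s n t) - (\<lambda>t. c * E A t) = (\<lambda>t. c * (T (s n) - E A) t)"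
        using s(1) by (simp add: T_scale X.cauchy_seqs_closed fun_eq_iff algebra_simps)
      then show ?thesis using ls s(1)
        by (simp add: Y.norm_scale Y.diff_closed T_closed X.cauchy_seqs_closed lim_def del: minus_apply)
    qed
    then have "lim (\<lambda>n t. c * s n t) (\<lambda>t. c * E A t)"
      using ls by (auto simp: lim_def Y.scale_closed intro: tendsto_mult_right_zero)
    then show "E (vscale ?X c A) = vscale Y c (E A)"
      unfolding s(2) X.completion_scale[OF s(1)] Y.vscale_apply
      by (intro E_eq X.cauchy_seqs_scale s) (simp add: s)
  qed
  have "inj_on E (vcarrier ?X)"
  proof (rule inj_onI)
    fix A B assume "A \<in> vcarrier ?X" "B \<in> vcarrier ?X" and eq: "E A = E B"
    then obtain s t where s: "s \<in> cauchy_seqs X" "A = null_rel X `` {s}"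
      and t: "t \<in> cauchy_seqs X" "B = null_rel X `` {t}"
      by (elim X.completion_carrierE)
    then show "A = B" using lim_eq_iff[OF s(1) _ t(1)] E_lim s t eq by metis
  qed
  moreover have "E ` vcarrier ?X = vcarrier Y"
  proof (intro equalityI subsetI)
    fix y assume y: "y \<in> vcarrier Y"
    have "\<forall>n. \<exists>x\<in>vcarrier X. vnorm Y (T x - y) < inverse (real (Suc n))"
      using dense[OF y] by simp
    then obtain s where s: "\<And>n. s n \<in> vcarrier X" "\<And>n. vnorm Y (T (s n) - y) < inverse (real (Suc n))"
      by metis
    have c: "T (s n) - y \<in> vcarrier Y" for n using s y by (simp add: T_closed Y.diff_closed)
    have l: "(\<lambda>n. vnorm Y (T (s n) - y)) \<longlonglongrightarrow> 0"
      by (rule Lim_null_comparison[OF _ LIMSEQ_inverse_real_of_nat])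
        (use s c Y.norm_nonneg in \<open>auto simp: less_imp_le\<close>)
    \<comment> \<open>The images converge to y, and the lower estimate transports their Cauchy
      property back to the preimages.\<close>
    have "s \<in> cauchy_seqs X"
      unfolding X.cauchy_seqs_iff
    proof safe
      fix e :: real assume e: "e > 0"
      define D where "D = K powr p + 1"
      have D: "D > 0" by (simp add: D_def add_nonneg_pos)
      have "(\<lambda>n. vnorm Y (T (s n) - y) powr p) \<longlonglongrightarrow> 0"
        using l c by (simp add: Y.norm_powr_tendsto_0)
      then have "\<forall>\<^sub>F n in sequentially. vnorm Y (T (s n) - y) powr p < e / (2 * D)"
        by (rule order_tendstoD) (use e D in simp)
      then obtain N where N: "\<And>n. n \<ge> N \<Longrightarrow> vnorm Y (T (s n) - y) powr p < e / (2 * D)"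
        by (auto simp: eventually_sequentially)
      have "vnorm X (s m - s n) powr p < e" if "m \<ge> N" "n \<ge> N" for m n
      proof -
        have "vnorm X (s m - s n) \<le> K * vnorm Y (T (s m) - T (s n))"
          using lower[OF X.diff_closed[OF s(1) s(1)]] s(1) by (simp add: T_diff)
        then have "vnorm X (s m - s n) powr p \<le> (K * vnorm Y (T (s m) - T (s n))) powr p"
          using s(1) X.norm_nonneg X.p_pos by (intro powr_mono2) (auto simp: X.diff_closed)
        also have "\<dots> = K powr p * vnorm Y (T (s m) - T (s n)) powr p"
          by (rule powr_mult)
        also have "\<dots> \<le> D * vnorm Y (T (s m) - T (s n)) powr p"
          by (simp add: D_def mult_right_mono)
        also have "\<dots> \<le> D * (vnorm Y (T (s m) - y) powr p + vnorm Y (T (s n) - y) powr p)"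
          using Y.norm_triangle[of "T (s m)" y "T (s n)"] Y.norm_minus_commute[of y "T (s n)"] D s(1) y
          by (simp add: T_closed)
        also have "\<dots> < D * (e / (2 * D) + e / (2 * D))"
          using N that D by (intro mult_strict_left_mono add_strict_mono) auto
        also have "\<dots> = e" using D by (simp add: field_simps)
        finally show ?thesis .
      qed
      then show "\<exists>N. \<forall>m\<ge>N. \<forall>n\<ge>N. vnorm X (s m - s n) powr p < e" by blast
    qed (rule s)
    then show "y \<in> E ` vcarrier ?X"
      using E_eq[of s y] l y X.class_in_completion by (force simp: lim_def)
  qed (use E_closed in auto)
  ultimately have bij: "bij_betw E (vcarrier ?X) (vcarrier Y)" by (simp add: bij_betw_def)
  let ?I = "inv_into (vcarrier ?X) E"
  have I_closed: "?I y \<in> vcarrier ?X" and E_I: "E (?I y) = y" if "y \<in> vcarrier Y" for y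
    using bij that by (auto simp: bij_betw_def inv_into_into f_inv_into_f)
  have I_upper: "vnorm ?X (?I y) \<le> K * vnorm Y y" if "y \<in> vcarrier Y" for y
    using E_lower[OF I_closed[OF that]] E_I[OF that] by simp
  have iso: "E \<in> isomorphisms ?X Y"
    using E_linear bij E_upper I_upper by (auto simp: isomorphisms_def bounded_map_def)
  \<comment> \<open>The zero class shows that the unit ball over which the operator norm is a
    supremum is non-empty.\<close>
  let ?z = "null_rel X `` {\<lambda>_. 0}"
  have z: "?z \<in> vcarrier ?X" "vnorm ?X ?z = 0"
    using X.class_in_completion[OF X.const_cauchy_seqs[OF X.zero_closed]]
      LIMSEQ_unique[OF X.completion_norm[OF X.const_cauchy_seqs[OF X.zero_closed]], of 0]
    by (auto simp: X.norm_zero)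
  have "op_norm ?X Y E \<le> C"
    unfolding op_norm_def
  proof (rule cSUP_least)
    fix A assume A: "A \<in> {A \<in> vcarrier ?X. vnorm ?X A \<le> 1}"
    then have "C * vnorm ?X A \<le> C * 1" using nonneg by (intro mult_left_mono) auto
    then show "vnorm Y (E A) \<le> C" using E_upper A by fastforce
  qed (use z in auto)
  moreover have I_bound: "vnorm ?X (?I y) \<le> K" if "y \<in> {y \<in> vcarrier Y. vnorm Y y \<le> 1}" for y
  proof -
    have "K * vnorm Y y \<le> K * 1" using nonneg that by (intro mult_left_mono) auto
    then show ?thesis using I_upper that by fastforce
  qed
  have "op_norm Y ?X ?I \<le> K"
    unfolding op_norm_def
    by (rule cSUP_least[OF _ I_bound]) (use Y.zero_closed Y.norm_zero in auto)
  \<comment> \<open>Multiplying the two bounds requires the second operator norm to be nonnegative;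
    evaluation at 0 supplies this.\<close>
  moreover have "0 \<le> op_norm Y ?X ?I"
  proof -
    have "bdd_above ((\<lambda>y. vnorm ?X (?I y)) ` {y \<in> vcarrier Y. vnorm Y y \<le> 1})"
      using I_bound by (auto simp: bdd_above_def)
    then have "vnorm ?X (?I 0) \<le> op_norm Y ?X ?I"
      unfolding op_norm_def using Y.zero_closed Y.norm_zero by (intro cSUP_upper[where x = 0]) auto
    then show ?thesis using norm_nonneg[OF I_closed[OF Y.zero_closed]] by linarith
  qed
  ultimately have "op_norm ?X Y E * op_norm Y ?X ?I \<le> C * K"
    using nonneg by (intro mult_mono) auto
  then show ?thesis
    unfolding banach_mazur_def using iso by (intro INF_lower2[of E]) auto
qed

section \<open>The spaces of p-summable families and the free p-norm\<close>

text \<open>A fraction c/s in [0,1] satisfies c/s \<le> (c/s)^p since p \<le> 1. Apply this to a/s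
  and b/s with s = a + b, whose sum is 1.\<close>

lemma powr_add_subadditive:
  fixes a b p :: real
  assumes "0 < p" "p \<le> 1" "0 \<le> a" "0 \<le> b"
  shows "(a + b) powr p \<le> a powr p + b powr p"
proof (cases "a + b = 0")
  case False
  define s where "s = a + b"
  have s: "s > 0" using assms False by (simp add: s_def)
  have le: "c / s * s powr p \<le> c powr p" if "0 \<le> c" "c \<le> s" for c
  proof -
    have "c / s = (c / s) powr 1" using that s by simp
    also have "\<dots> \<le> (c / s) powr p" using that s assms by (intro powr_mono') auto
    finally have "c / s * s powr p \<le> (c / s) powr p * s powr p" by (intro mult_right_mono) auto
    also have "\<dots> = c powr p" using that s by (simp flip: powr_mult)
    finally show ?thesis .
  qed
  have "s powr p = a / s * s powr p + b / s * s powr p"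
    using s by (simp add: s_def flip: distrib_right add_divide_distrib)
  also have "\<dots> \<le> a powr p + b powr p" using assms by (intro add_mono le) (auto simp: s_def)
  finally show ?thesis by (simp add: s_def)
qed (use assms in auto)

lemma abs_powr_add_le:
  fixes a b p :: real
  assumes "0 < p" "p \<le> 1"
  shows "\<bar>a + b\<bar> powr p \<le> \<bar>a\<bar> powr p + \<bar>b\<bar> powr p"
proof -
  have "\<bar>a + b\<bar> powr p \<le> (\<bar>a\<bar> + \<bar>b\<bar>) powr p" using assms by (intro powr_mono2) auto
  also have "\<dots> \<le> \<bar>a\<bar> powr p + \<bar>b\<bar> powr p" using assms by (intro powr_add_subadditive) auto
  finally show ?thesis .
qed

lemma abs_powr_sum_le:
  fixes f :: "'a \<Rightarrow> real"
  assumes "0 < p" "p \<le> 1"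
  shows "\<bar>\<Sum>i\<in>I. f i\<bar> powr p \<le> (\<Sum>i\<in>I. \<bar>f i\<bar> powr p)"
proof (induction I rule: infinite_finite_induct)
  case (insert i I)
  then show ?case using abs_powr_add_le[OF assms, of "f i" "sum f I"] by simp
qed auto

section \<open>The spaces l_p(V) for p at most 1\<close>

context
  fixes p :: real and V :: "'b set"
  assumes p: "0 < p" "p \<le> 1"
begin

lemma lp_carrier_iff:
  "a \<in> vcarrier (lp_space p V) \<longleftrightarrow>
    (\<forall>v. v \<notin> V \<longrightarrow> a v = 0) \<and> (\<lambda>v. \<bar>a v\<bar> powr p) summable_on V"
  by (simp add: lp_space_def)

lemma lp_norm_eq: "vnorm (lp_space p V) a = (\<Sum>\<^sub>\<infinity>v\<in>V. \<bar>a v\<bar> powr p) powr (1 / p)"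
  by (simp add: lp_space_def)

lemma lp_norm_powr: "vnorm (lp_space p V) a powr p = (\<Sum>\<^sub>\<infinity>v\<in>V. \<bar>a v\<bar> powr p)"
  using p by (simp add: lp_norm_eq powr_powr infsum_nonneg)

text \<open>A uniform bound on finite partial sums yields membership and the norm estimate together,
  so later arguments only meet finite sums.\<close>

lemma lp_norm_leI:
  assumes "\<And>v. v \<notin> V \<Longrightarrow> a v = 0"
    and "\<And>F. finite F \<Longrightarrow> F \<subseteq> V \<Longrightarrow> (\<Sum>v\<in>F. \<bar>a v\<bar> powr p) \<le> r"
  shows "a \<in> vcarrier (lp_space p V)" "vnorm (lp_space p V) a powr p \<le> r"
proof -
  have *: "(\<lambda>v. \<bar>a v\<bar> powr p) summable_on V"
    using assms by (intro nonneg_bdd_above_summable_on) (auto simp: bdd_above_def)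
  then show "a \<in> vcarrier (lp_space p V)" using assms by (simp add: lp_carrier_iff)
  show "vnorm (lp_space p V) a powr p \<le> r"
    unfolding lp_norm_powr using * assms by (intro infsum_le_finite_sums) auto
qed

lemma lp_sum_le_norm:
  assumes "a \<in> vcarrier (lp_space p V)" "finite F" "F \<subseteq> V"
  shows "(\<Sum>v\<in>F. \<bar>a v\<bar> powr p) \<le> vnorm (lp_space p V) a powr p"
  unfolding lp_norm_powr using assms by (intro finite_sum_le_infsum) (auto simp: lp_carrier_iff)

lemma pnormed_lp_space: "pnormed_fun_space (lp_space p V) p"
proof
  show "0 < p" by (fact p)
  show "vadd (lp_space p V) = (\<lambda>f g t. f t + g t)" "vscale (lp_space p V) = (\<lambda>c f t. c * f t)"
    by (simp_all add: lp_space_def)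
  show "0 \<in> vcarrier (lp_space p V)" using p by (simp add: lp_carrier_iff)
next
  fix x y assume x: "x \<in> vcarrier (lp_space p V)" and y: "y \<in> vcarrier (lp_space p V)"
  have "(\<Sum>v\<in>F. \<bar>(x + y) v\<bar> powr p) \<le> vnorm (lp_space p V) x powr p + vnorm (lp_space p V) y powr p"
    if "finite F" "F \<subseteq> V" for F
  proof -
    have "(\<Sum>v\<in>F. \<bar>(x + y) v\<bar> powr p) \<le> (\<Sum>v\<in>F. \<bar>x v\<bar> powr p + \<bar>y v\<bar> powr p)"
      using abs_powr_add_le[OF p] by (intro sum_mono) auto
    also have "\<dots> \<le> vnorm (lp_space p V) x powr p + vnorm (lp_space p V) y powr p"
      using lp_sum_le_norm[OF x that] lp_sum_le_norm[OF y that] by (simp add: sum.distrib)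
    finally show ?thesis .
  qed
  then show "x + y \<in> vcarrier (lp_space p V)"
    "vnorm (lp_space p V) (x + y) powr p \<le> vnorm (lp_space p V) x powr p + vnorm (lp_space p V) y powr p"
    using lp_norm_leI[of "x + y" "vnorm (lp_space p V) x powr p + vnorm (lp_space p V) y powr p"] x y
    by (simp_all add: lp_carrier_iff)
next
  fix x c assume x: "x \<in> vcarrier (lp_space p V)"
  have eq: "\<bar>c * x t\<bar> powr p = \<bar>c\<bar> powr p * \<bar>x t\<bar> powr p" for t
    by (simp add: abs_mult powr_mult)
  show "(\<lambda>t. c * x t) \<in> vcarrier (lp_space p V)"
    using x by (auto simp: lp_carrier_iff eq intro: summable_on_cmult_right)
  have "(\<Sum>\<^sub>\<infinity>v\<in>V. \<bar>c * x v\<bar> powr p) = \<bar>c\<bar> powr p * (\<Sum>\<^sub>\<infinity>v\<in>V. \<bar>x v\<bar> powr p)"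
    unfolding eq by (rule infsum_cmult_right')
  then show "vnorm (lp_space p V) (\<lambda>t. c * x t) = \<bar>c\<bar> * vnorm (lp_space p V) x"
    using p by (simp add: lp_norm_eq powr_mult powr_powr infsum_nonneg)
next
  fix x show "0 \<le> vnorm (lp_space p V) x" by (simp add: lp_norm_eq)
qed

lemma lp_norm_eq_0:
  assumes a: "a \<in> vcarrier (lp_space p V)" "vnorm (lp_space p V) a = 0"
  shows "a = 0"
proof
  fix v show "a v = 0 v"
  proof (cases "v \<in> V")
    case True
    then have "(\<Sum>v\<in>{v}. \<bar>a v\<bar> powr p) \<le> 0"
      using lp_sum_le_norm[OF a(1), of "{v}"] a(2) p by simp
    then show ?thesis by simp
  qed (use a in \<open>simp add: lp_carrier_iff\<close>)
qed

text \<open>The limit is taken coordinatewise. On a finite set of coordinates the Cauchy estimate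
  for \<open>s m - s n\<close> survives n tending to infinity, with a bound independent of the
  finite set.\<close>

lemma lp_complete:
  assumes s: "s \<in> cauchy_seqs (lp_space p V)"
  shows "\<exists>a\<in>vcarrier (lp_space p V). (\<lambda>n. vnorm (lp_space p V) (s n - a)) \<longlonglongrightarrow> 0"
proof -
  interpret pnormed_fun_space "lp_space p V" p by (rule pnormed_lp_space)
  let ?N = "\<lambda>a. vnorm (lp_space p V) a powr p"
  have sc: "s n \<in> vcarrier (lp_space p V)" for n using s by (simp add: cauchy_seqs_closed)
  have cauchy: "\<exists>N. \<forall>m\<ge>N. \<forall>n\<ge>N. ?N (s m - s n) < e" if "e > 0" for e
    using s that by (simp add: cauchy_seqs_iff)
  have coord: "Cauchy (\<lambda>n. s n v)" for v
  proof (cases "v \<in> V")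
    case True
    show ?thesis
    proof (rule metric_CauchyI)
      fix e :: real assume e: "e > 0"
      with cauchy[of "e powr p"] obtain N where N: "\<And>m n. m \<ge> N \<Longrightarrow> n \<ge> N \<Longrightarrow> ?N (s m - s n) < e powr p"
        by auto
      have "dist (s m v) (s n v) < e" if "m \<ge> N" "n \<ge> N" for m n
      proof -
        have "(\<Sum>v\<in>{v}. \<bar>(s m - s n) v\<bar> powr p) \<le> ?N (s m - s n)"
          using True sc by (intro lp_sum_le_norm diff_closed) auto
        also have "\<dots> < e powr p" using N that by blast
        finally have "\<bar>s m v - s n v\<bar> powr p < e powr p" by simp
        then show ?thesis using e p powr_mono2[of p e "\<bar>s m v - s n v\<bar>"]
          by (force simp: dist_real_def)
      qed
      then show "\<exists>N. \<forall>m\<ge>N. \<forall>n\<ge>N. dist (s m v) (s n v) < e" by blast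
    qed
  next
    case False
    then have "(\<lambda>n. s n v) = (\<lambda>n. 0)" using sc by (auto simp: lp_carrier_iff)
    then show ?thesis by (metis convergent_Cauchy convergent_const)
  qed
  define a where "a v = lim (\<lambda>n. s n v)" for v
  have lim: "(\<lambda>n. s n v) \<longlonglongrightarrow> a v" for v
    using coord[of v] by (simp add: a_def Cauchy_convergent_iff convergent_LIMSEQ_iff)
  have a0: "a v = 0" if "v \<notin> V" for v
  proof -
    have "s n v = 0" for n using sc[of n] that by (simp add: lp_carrier_iff)
    then show ?thesis using lim[of v] by (simp add: LIMSEQ_const_iff)
  qed
  have close: "s m - a \<in> vcarrier (lp_space p V) \<and> ?N (s m - a) \<le> e"
    if "\<And>m n. m \<ge> N \<Longrightarrow> n \<ge> N \<Longrightarrow> ?N (s m - s n) < e" "m \<ge> N" for e N m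
  proof -
    have "(\<Sum>v\<in>F. \<bar>(s m - a) v\<bar> powr p) \<le> e" if F: "finite F" "F \<subseteq> V" for F
    proof (rule LIMSEQ_le_const2)
      show "(\<lambda>n. \<Sum>v\<in>F. \<bar>(s m - s n) v\<bar> powr p) \<longlonglongrightarrow> (\<Sum>v\<in>F. \<bar>(s m - a) v\<bar> powr p)"
        using p by (intro tendsto_sum tendsto_powr2 always_eventually) (auto intro!: tendsto_intros lim)
      have "(\<Sum>v\<in>F. \<bar>(s m - s n) v\<bar> powr p) \<le> e" if "n \<ge> N" for n
      proof -
        have "(\<Sum>v\<in>F. \<bar>(s m - s n) v\<bar> powr p) \<le> ?N (s m - s n)"
          using F sc by (intro lp_sum_le_norm diff_closed) auto
        also have "\<dots> \<le> e" using \<open>\<And>m n. m \<ge> N \<Longrightarrow> n \<ge> N \<Longrightarrow> ?N (s m - s n) < e\<close>[of m n] \<open>m \<ge> N\<close> that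
          by simp
        finally show ?thesis .
      qed
      then show "\<exists>N. \<forall>n\<ge>N. (\<Sum>v\<in>F. \<bar>(s m - s n) v\<bar> powr p) \<le> e" by blast
    qed
    then show ?thesis using sc[of m] a0 lp_norm_leI[of "s m - a" e] by (auto simp: lp_carrier_iff)
  qed
  obtain N where N: "\<And>m n. m \<ge> N \<Longrightarrow> n \<ge> N \<Longrightarrow> ?N (s m - s n) < 1"
    using cauchy[of 1] by auto
  \<comment> \<open>Only differences from \<open>a\<close> are known to be p-summable so far;
    \<open>a\<close> itself is recovered from one of them.\<close>
  have "s N - (s N - a) \<in> vcarrier (lp_space p V)"
    using close[OF N, of N] sc[of N] diff_closed[of "s N" "s N - a"] by blast
  then have ac: "a \<in> vcarrier (lp_space p V)" by (simp add: algebra_simps)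
  have "(\<lambda>n. ?N (s n - a)) \<longlonglongrightarrow> 0"
  proof (rule LIMSEQ_I)
    fix e :: real assume "e > 0"
    then obtain N where N: "\<And>m n. m \<ge> N \<Longrightarrow> n \<ge> N \<Longrightarrow> ?N (s m - s n) < e / 2"
      using cauchy[of "e / 2"] by auto
    have "norm (?N (s n - a) - 0) < e" if "n \<ge> N" for n
      using close[OF N that] \<open>e > 0\<close> by auto
    then show "\<exists>N. \<forall>n\<ge>N. norm (?N (s n - a) - 0) < e" by blast
  qed
  then show ?thesis using ac sc by (auto simp: norm_powr_tendsto_0 diff_closed)
qed

lemma lp_finite_support_dense:
  assumes a: "a \<in> vcarrier (lp_space p V)" and e: "0 < e"
  shows "\<exists>F. finite F \<and> F \<subseteq> V \<and> vnorm (lp_space p V) ((\<lambda>v. if v \<in> F then a v else 0) - a) < e"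
proof -
  have sm: "(\<lambda>v. \<bar>a v\<bar> powr p) summable_on V" using a by (simp add: lp_carrier_iff)
  then have "((\<lambda>v. \<bar>a v\<bar> powr p) has_sum vnorm (lp_space p V) a powr p) V"
    unfolding lp_norm_powr by (rule has_sum_infsum)
  \<comment> \<open>Half of e is used because the bound on all finite partial sums passes to the
    norm only as a weak inequality.\<close>
  then have "\<forall>\<^sub>F F in finite_subsets_at_top V.
      dist (\<Sum>v\<in>F. \<bar>a v\<bar> powr p) (vnorm (lp_space p V) a powr p) < (e / 2) powr p"
    unfolding has_sum_def by (rule tendstoD) (use e in simp)
  then obtain F where F: "finite F" "F \<subseteq> V"
    and close: "dist (\<Sum>v\<in>F. \<bar>a v\<bar> powr p) (vnorm (lp_space p V) a powr p) < (e / 2) powr p"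
    by (auto simp: eventually_finite_subsets_at_top)
  let ?d = "(\<lambda>v. if v \<in> F then a v else 0) - a"
  have "(\<Sum>v\<in>G. \<bar>?d v\<bar> powr p) \<le> (e / 2) powr p" if G: "finite G" "G \<subseteq> V" for G
  proof -
    have "(\<Sum>v\<in>G. \<bar>?d v\<bar> powr p) = (\<Sum>v\<in>G - F. \<bar>a v\<bar> powr p)"
      using G by (intro sum.mono_neutral_cong_right) auto
    also have "\<dots> = (\<Sum>v\<in>G \<union> F. \<bar>a v\<bar> powr p) - (\<Sum>v\<in>F. \<bar>a v\<bar> powr p)"
      using F G by (simp add: sum_diff[of "G \<union> F" F, symmetric] Un_Diff)
    also have "\<dots> \<le> vnorm (lp_space p V) a powr p - (\<Sum>v\<in>F. \<bar>a v\<bar> powr p)"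
      using lp_sum_le_norm[OF a, of "G \<union> F"] F G by simp
    also have "\<dots> \<le> (e / 2) powr p" using close by (simp add: dist_real_def abs_if split: if_splits)
    finally show ?thesis .
  qed
  then have "vnorm (lp_space p V) ?d powr p \<le> (e / 2) powr p"
    using a F by (intro lp_norm_leI) (auto simp: lp_carrier_iff)
  then have "vnorm (lp_space p V) ?d powr p < e powr p"
    using e p powr_less_mono2[of p "e / 2" e] by linarith
  then have "vnorm (lp_space p V) ?d < e"
    using e p powr_mono2[of p e "vnorm (lp_space p V) ?d"] by force
  then show ?thesis using F by blast
qed

end

text \<open>The \<open>p\<close>-th powers of the costs of the representations admitted in \<^const>\<open>free_norm\<close>.\<close>

definition molecular_cost ::
  "real \<Rightarrow> 'a set \<Rightarrow> ('a \<Rightarrow> 'a \<Rightarrow> real) \<Rightarrow> 'a \<Rightarrow> ('a \<Rightarrow> real) \<Rightarrow> real \<Rightarrow> bool" where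
  "molecular_cost p M \<sigma> z m r \<longleftrightarrow> (\<exists>(n::nat) a x y.
     r = (\<Sum>i<n. \<bar>a i\<bar> powr p) \<and>
     (\<forall>i<n. x i \<in> M \<and> y i \<in> M \<and> x i \<noteq> y i) \<and>
     m = (\<lambda>t. \<Sum>i<n. a i * ((delta z (x i) t - delta z (y i) t) / \<sigma> (x i) (y i))))"

section \<open>The free p-norm as an infimum of costs\<close>

locale free_pnormed =
  fixes p :: real and M :: "'a set" and \<sigma> :: "'a \<Rightarrow> 'a \<Rightarrow> real" and z :: 'a
  assumes p: "0 < p" "p \<le> 1"
    and base: "z \<in> M"
    and pos: "x \<in> M \<Longrightarrow> y \<in> M \<Longrightarrow> x \<noteq> y \<Longrightarrow> 0 < \<sigma> x y"
begin

abbreviation "P \<equiv> free_pre_space p M \<sigma> z"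
abbreviation "cost \<equiv> molecular_cost p M \<sigma> z"

lemma carrier_iff: "m \<in> vcarrier P \<longleftrightarrow> finite {t. m t \<noteq> 0} \<and> {t. m t \<noteq> 0} \<subseteq> M - {z}"
  by (simp add: free_pre_space_def)

lemma norm_eq_Inf: "vnorm P m = Inf {r powr (1 / p) | r. cost m r}"
  unfolding free_pre_space_def free_norm_def molecular_cost_def qspace.select_convs
  by (rule arg_cong[where f = Inf], rule set_eqI, unfold mem_Collect_eq, blast)

lemma cost_nonneg: "cost m r \<Longrightarrow> 0 \<le> r"
  by (auto simp: molecular_cost_def intro: sum_nonneg)

lemma cost_zero: "cost 0 0"
  unfolding molecular_cost_def by (intro exI[of _ 0]) auto

text \<open>Concatenate the two representations, shifting the indices of the second by
  \<open>n\<close>.\<close>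

lemma cost_add:
  assumes "cost m r" "cost m' r'"
  shows "cost (m + m') (r + r')"
proof -
  obtain n :: nat and a x y where 1: "r = (\<Sum>i<n. \<bar>a i\<bar> powr p)"
    "\<forall>i<n. x i \<in> M \<and> y i \<in> M \<and> x i \<noteq> y i"
    "m = (\<lambda>t. \<Sum>i<n. a i * ((delta z (x i) t - delta z (y i) t) / \<sigma> (x i) (y i)))"
    using assms(1) unfolding molecular_cost_def by blast
  obtain n' :: nat and a' x' y' where 2: "r' = (\<Sum>i<n'. \<bar>a' i\<bar> powr p)"
    "\<forall>i<n'. x' i \<in> M \<and> y' i \<in> M \<and> x' i \<noteq> y' i"
    "m' = (\<lambda>t. \<Sum>i<n'. a' i * ((delta z (x' i) t - delta z (y' i) t) / \<sigma> (x' i) (y' i)))"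
    using assms(2) unfolding molecular_cost_def by blast
  have split: "(\<Sum>i<n + n'. if i < n then f i else g (i - n)) = (\<Sum>i<n. f i) + (\<Sum>i<n'. g i)"
    for f g :: "nat \<Rightarrow> real"
    by (induction n') auto
  let ?j = "\<lambda>f g (i::nat). if i < n then f i else g (i - n)"
  show ?thesis unfolding molecular_cost_def
  proof (intro exI conjI)
    show "r + r' = (\<Sum>i<n + n'. \<bar>?j a a' i\<bar> powr p)"
      using split[of "\<lambda>i. \<bar>a i\<bar> powr p" "\<lambda>i. \<bar>a' i\<bar> powr p"] 1 2
      by (simp add: if_distrib[of "\<lambda>u. \<bar>u\<bar> powr p"] cong: if_cong)
    show "\<forall>i<n + n'. ?j x x' i \<in> M \<and> ?j y y' i \<in> M \<and> ?j x x' i \<noteq> ?j y y' i"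
      using 1 2 by auto
    show "m + m' = (\<lambda>t. \<Sum>i<n + n'. ?j a a' i *
        ((delta z (?j x x' i) t - delta z (?j y y' i) t) / \<sigma> (?j x x' i) (?j y y' i)))"
    proof
      fix t
      have "(\<Sum>i<n + n'. ?j a a' i *
          ((delta z (?j x x' i) t - delta z (?j y y' i) t) / \<sigma> (?j x x' i) (?j y y' i)))
        = (\<Sum>i<n + n'. if i < n then a i * ((delta z (x i) t - delta z (y i) t) / \<sigma> (x i) (y i))
            else a' (i - n) * ((delta z (x' (i - n)) t - delta z (y' (i - n)) t) / \<sigma> (x' (i - n)) (y' (i - n))))"
        by (intro sum.cong) auto
      also have "\<dots> = (m + m') t"
        unfolding 1 2 plus_fun_apply
        by (rule split[of "\<lambda>i. a i * ((delta z (x i) t - delta z (y i) t) / \<sigma> (x i) (y i))"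
              "\<lambda>i. a' i * ((delta z (x' i) t - delta z (y' i) t) / \<sigma> (x' i) (y' i))"])
      finally show "(m + m') t = (\<Sum>i<n + n'. ?j a a' i *
          ((delta z (?j x x' i) t - delta z (?j y y' i) t) / \<sigma> (?j x x' i) (?j y y' i)))" by simp
    qed
  qed
qed

lemma cost_scale:
  assumes "cost m r"
  shows "cost (\<lambda>t. c * m t) (\<bar>c\<bar> powr p * r)"
proof -
  obtain n :: nat and a x y where 1: "r = (\<Sum>i<n. \<bar>a i\<bar> powr p)"
    "\<forall>i<n. x i \<in> M \<and> y i \<in> M \<and> x i \<noteq> y i"
    "m = (\<lambda>t. \<Sum>i<n. a i * ((delta z (x i) t - delta z (y i) t) / \<sigma> (x i) (y i)))"
    using assms(1) unfolding molecular_cost_def by blast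
  show ?thesis unfolding molecular_cost_def
    by (rule exI[of _ n], rule exI[of _ "\<lambda>i. c * a i"], rule exI[of _ x], rule exI[of _ y])
      (use 1 in \<open>auto simp: abs_mult powr_mult sum_distrib_left mult.assoc\<close>)
qed

text \<open>Representations exclude x = y, so the diagonal case uses the empty one. It does occur:
  rounding a point to a grid may leave it fixed.\<close>

lemma cost_delta_diff:
  assumes "x \<in> M" "y \<in> M"
  shows "cost (\<lambda>t. delta z x t - delta z y t) (if x = y then 0 else \<sigma> x y powr p)"
proof (cases "x = y")
  case True
  then show ?thesis using cost_zero by (simp add: zero_fun_def)
next
  case False
  then show ?thesis unfolding molecular_cost_def
    using pos[OF assms] assms
    by (intro exI[of _ "1::nat"] exI[of _ "\<lambda>_. \<sigma> x y"] exI[of _ "\<lambda>_. x"] exI[of _ "\<lambda>_. y"]) auto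
qed

lemma delta_expansion:
  assumes "finite {t. m t \<noteq> 0}" "m z = 0"
  shows "m = (\<lambda>t. \<Sum>x | m x \<noteq> 0. m x * delta z x t)"
proof
  fix t
  have "(\<Sum>x | m x \<noteq> 0. m x * delta z x t) = (\<Sum>x | m x \<noteq> 0. if x = t then m x else 0)"
    using assms by (intro sum.cong) (auto simp: delta_def)
  also have "\<dots> = m t" using assms by simp
  finally show "m t = (\<Sum>x | m x \<noteq> 0. m x * delta z x t)" by simp
qed

lemma cost_sum:
  assumes "\<And>i. i \<in> I \<Longrightarrow> cost (f i) (r i)"
  shows "cost (\<lambda>t. \<Sum>i\<in>I. f i t) (\<Sum>i\<in>I. r i)"
  using assms
proof (induction I rule: infinite_finite_induct)
  case (insert i I)
  then show ?case using cost_add[of "f i" "r i" "\<lambda>t. \<Sum>i\<in>I. f i t" "\<Sum>i\<in>I. r i"]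
    by (simp add: plus_fun_def)
qed (use cost_zero in \<open>simp_all add: zero_fun_def\<close>)

text \<open>Makes the infimum in the free norm one over a non-empty set: since \<delta>(z) = 0, each
  \<delta>(x) is \<delta>(x) - \<delta>(z), a multiple of a molecule or zero.\<close>

lemma cost_exists:
  assumes "m \<in> vcarrier P"
  shows "\<exists>r. cost m r"
proof -
  have *: "finite {t. m t \<noteq> 0}" "m z = 0" "{t. m t \<noteq> 0} \<subseteq> M" using assms by (auto simp: carrier_iff)
  have "\<exists>r. cost (\<lambda>t. m x * delta z x t) r" if "m x \<noteq> 0" for x
  proof -
    have "delta z x t - delta z z t = delta z x t" for t by (simp add: delta_def)
    then show ?thesis using cost_scale[OF cost_delta_diff[of x z], of "m x"] that *(3) base by auto
  qed
  then obtain r where "\<And>x. m x \<noteq> 0 \<Longrightarrow> cost (\<lambda>t. m x * delta z x t) (r x)" by metis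
  then have "cost (\<lambda>t. \<Sum>x | m x \<noteq> 0. m x * delta z x t) (\<Sum>x | m x \<noteq> 0. r x)"
    by (intro cost_sum) auto
  then show ?thesis by (subst delta_expansion[OF *(1,2)]) (rule exI)
qed

lemma norm_powr_le_cost:
  assumes "cost m r"
  shows "vnorm P m powr p \<le> r"
proof -
  have r: "0 \<le> r" using assms by (rule cost_nonneg)
  have "vnorm P m \<le> r powr (1 / p)" unfolding norm_eq_Inf
    using assms by (intro cInf_lower) (auto intro: bdd_belowI[of _ 0])
  moreover have "0 \<le> vnorm P m" unfolding norm_eq_Inf
    using assms by (intro cInf_greatest) auto
  ultimately have "vnorm P m powr p \<le> (r powr (1 / p)) powr p"
    using p by (intro powr_mono2) auto
  then show ?thesis using p r by (simp add: powr_powr)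
qed

lemma cost_near_norm:
  assumes "m \<in> vcarrier P" "0 < e"
  obtains r where "cost m r" "r < vnorm P m powr p + e"
proof (rule ccontr)
  define N where "N = vnorm P m powr p"
  assume "\<not> thesis"
  then have le: "N + e \<le> r" if "cost m r" for r
    unfolding N_def using that \<open>\<And>r. cost m r \<Longrightarrow> r < vnorm P m powr p + e \<Longrightarrow> thesis\<close>
    by (meson linorder_not_less)
  have "0 \<le> N" by (simp add: N_def)
  have "(N + e) powr (1 / p) \<le> vnorm P m" unfolding norm_eq_Inf
    using cost_exists[OF assms(1)] le assms p \<open>0 \<le> N\<close>
    by (intro cInf_greatest) (auto intro!: powr_mono2)
  then have "((N + e) powr (1 / p)) powr p \<le> N"
    unfolding N_def using p by (intro powr_mono2) auto
  then show False using p assms \<open>0 \<le> N\<close> by (simp add: powr_powr)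
qed

text \<open>The way to bound something by the free norm: check the bound on each single
  representation, then pass to the infimum.\<close>

lemma norm_powr_leI:
  assumes "m \<in> vcarrier P" "\<And>r. cost m r \<Longrightarrow> u \<le> c * r" "0 \<le> c"
  shows "u \<le> c * vnorm P m powr p"
proof (rule field_le_epsilon)
  fix e :: real assume e: "0 < e"
  \<comment> \<open>Dividing by c + 1 instead of c covers c = 0.\<close>
  then have "0 < e / (c + 1)" using assms by simp
  from cost_near_norm[OF assms(1) this] obtain r where
    r: "cost m r" "r < vnorm P m powr p + e / (c + 1)" .
  have "u \<le> c * r" by (rule assms(2)) (rule r)
  also have "\<dots> \<le> c * (vnorm P m powr p + e / (c + 1))"
    using r assms by (intro mult_left_mono) auto
  also have "\<dots> \<le> c * vnorm P m powr p + e"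
    using assms e by (simp add: field_simps)
  finally show "u \<le> c * vnorm P m powr p + e" .
qed

lemma pnormed: "pnormed_fun_space P p"
proof
  show "0 < p" by (fact p)
  show "vadd P = (\<lambda>f g t. f t + g t)" "vscale P = (\<lambda>c f t. c * f t)"
    by (simp_all add: free_pre_space_def)
  show "0 \<in> vcarrier P" by (simp add: carrier_iff)
next
  fix x y assume x: "x \<in> vcarrier P" and y: "y \<in> vcarrier P"
  have sub: "{t. (x + y) t \<noteq> 0} \<subseteq> {t. x t \<noteq> 0} \<union> {t. y t \<noteq> 0}" by auto
  then have "finite {t. (x + y) t \<noteq> 0}"
    by (rule finite_subset) (use x y in \<open>auto simp: carrier_iff\<close>)
  then show "x + y \<in> vcarrier P" using x y sub by (auto simp: carrier_iff)
  \<comment> \<open>The two infima are taken in turn: a representation of x is held fixed while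
    those of y vary, and then x is released.\<close>
  have 1: "vnorm P (x + y) powr p - r \<le> 1 * vnorm P y powr p" if "cost x r" for r
    using norm_powr_le_cost[OF cost_add[OF that]] y by (intro norm_powr_leI) force+
  have "vnorm P (x + y) powr p - vnorm P y powr p \<le> 1 * vnorm P x powr p"
    using x by (rule norm_powr_leI) (use 1 in force)+
  then show "vnorm P (x + y) powr p \<le> vnorm P x powr p + vnorm P y powr p" by simp
next
  fix x assume x: "x \<in> vcarrier P"
  show nn: "0 \<le> vnorm P x" unfolding norm_eq_Inf
    using cost_exists[OF x] by (intro cInf_greatest) auto
next
  have nn: "0 \<le> vnorm P x" if "x \<in> vcarrier P" for x unfolding norm_eq_Inf
    using cost_exists[OF that] by (intro cInf_greatest) auto
  have closed: "(\<lambda>t. c * x t) \<in> vcarrier P" if "x \<in> vcarrier P" for x c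
    using that by (auto simp: carrier_iff elim!: finite_subset[rotated])
  have le: "vnorm P (\<lambda>t. c * x t) powr p \<le> \<bar>c\<bar> powr p * vnorm P x powr p" if "x \<in> vcarrier P" for x c
    using norm_powr_le_cost[OF cost_scale] that by (intro norm_powr_leI) auto
  have le': "vnorm P (\<lambda>t. c * x t) \<le> \<bar>c\<bar> * vnorm P x" if "x \<in> vcarrier P" for x c
  proof -
    have "vnorm P (\<lambda>t. c * x t) powr p \<le> (\<bar>c\<bar> * vnorm P x) powr p"
      using le[OF that, of c] by (simp only: powr_mult)
    moreover have "0 \<le> \<bar>c\<bar> * vnorm P x" using nn[OF that] by simp
    ultimately show ?thesis
      using p powr_less_mono2[of p "\<bar>c\<bar> * vnorm P x" "vnorm P (\<lambda>t. c * x t)"] by linarith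
  qed
  fix x c assume x: "x \<in> vcarrier P"
  show "(\<lambda>t. c * x t) \<in> vcarrier P" using x by (rule closed)
  show "vnorm P (\<lambda>t. c * x t) = \<bar>c\<bar> * vnorm P x"
  proof (cases "c = 0")
    case True
    then show ?thesis using le'[OF x, of 0] nn[OF closed[OF x, of 0]] by simp
  next
    case False
    \<comment> \<open>Homogeneity needs only the inequality for every scalar: applying it to the
      inverse of c gives the converse.\<close>
    have "vnorm P (\<lambda>t. inverse c * (c * x t)) \<le> \<bar>inverse c\<bar> * vnorm P (\<lambda>t. c * x t)"
      by (rule le'[OF closed[OF x]])
    moreover have "(\<lambda>t. inverse c * (c * x t)) = x" using False by auto
    ultimately have "\<bar>c\<bar> * vnorm P x \<le> vnorm P (\<lambda>t. c * x t)"
      using False by (simp add: field_simps)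
    with le'[OF x, of c] show ?thesis by simp
  qed
qed

end

section \<open>Dyadic grids and hat functions\<close>

definition grid :: "nat \<Rightarrow> (real ^ 'd) set" where
  "grid k = cbox 0 1 \<inter> {x. \<forall>i. 2 ^ k * x $ i \<in> \<int>}"

text \<open>The vertices of the smallest level-k grid face containing x, indexed by the set S of
  coordinates rounded up. When a coordinate of x already lies on the grid, different S give the same
  vertex.\<close>

definition corner :: "nat \<Rightarrow> real ^ 'd \<Rightarrow> 'd set \<Rightarrow> real ^ 'd" where
  "corner k x S = (\<chi> i. of_int (if i \<in> S then \<lceil>2 ^ k * x $ i\<rceil> else \<lfloor>2 ^ k * x $ i\<rfloor>) / 2 ^ k)"

definition tent :: "nat \<Rightarrow> real \<Rightarrow> real \<Rightarrow> real" where
  "tent k b t = max 0 (1 - 2 ^ k * \<bar>t - b\<bar>)"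

definition hat :: "nat \<Rightarrow> real ^ 'd \<Rightarrow> real ^ 'd \<Rightarrow> real" where
  "hat k u x = (\<Prod>i\<in>UNIV. tent k (u $ i) (x $ i))"

definition level :: "real ^ 'd \<Rightarrow> nat" where
  "level v = (LEAST k. v \<in> grid k)"

lemma dyadic_points_eq: "dyadic_points = (\<Union>k. grid k) - {0}"
proof -
  have "(\<exists>j::int. y = of_int j / 2 ^ k) \<longleftrightarrow> 2 ^ k * y \<in> \<int>" for y :: real and k
    by (auto simp: Ints_def field_simps)
  then show ?thesis by (simp add: dyadic_points_def grid_def)
qed

lemma grid_mono:
  assumes "j \<le> k" shows "grid j \<subseteq> grid k"
proof
  fix x :: "real ^ 'd" assume x: "x \<in> grid j"
  have "2 ^ k * x $ i \<in> \<int>" for i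
  proof -
    have "2 ^ (k - j) * (2 ^ j * x $ i) \<in> \<int>" using x by (intro Ints_mult[of "2 ^ (k - j)"]) (auto simp: grid_def)
    then show ?thesis using assms by (simp flip: power_add mult.assoc)
  qed
  then show "x \<in> grid k" using x by (simp add: grid_def)
qed

lemma zero_in_grid: "0 \<in> grid k"
  by (simp add: grid_def mem_box_cart)

lemma in_grid_level: "v \<in> dyadic_points \<Longrightarrow> v \<in> grid (level v)"
  unfolding level_def dyadic_points_eq by (auto intro: LeastI)

lemma level_le: "v \<in> grid k \<Longrightarrow> level v \<le> k"
  unfolding level_def by (rule Least_le)

lemma corner_in_grid:
  assumes "x \<in> cbox 0 1" shows "corner k x S \<in> grid k"
proof -
  have x: "0 \<le> x $ i" "x $ i \<le> 1" for i using assms by (auto simp: mem_box_cart)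
  have "0 \<le> \<lfloor>2 ^ k * x $ i\<rfloor>" "0 \<le> \<lceil>2 ^ k * x $ i\<rceil>" "\<lceil>2 ^ k * x $ i\<rceil> \<le> 2 ^ k" "\<lfloor>2 ^ k * x $ i\<rfloor> \<le> 2 ^ k" for i
  proof -
    have "0 \<le> 2 ^ k * x $ i" "2 ^ k * x $ i \<le> of_int (2 ^ k)" using x[of i] by (auto simp: mult_left_le)
    then show "0 \<le> \<lfloor>2 ^ k * x $ i\<rfloor>" "0 \<le> \<lceil>2 ^ k * x $ i\<rceil>" "\<lceil>2 ^ k * x $ i\<rceil> \<le> 2 ^ k" "\<lfloor>2 ^ k * x $ i\<rfloor> \<le> 2 ^ k"
      by (simp_all only: ceiling_le_iff zero_le_floor) linarith+
  qed
  then have "of_int \<lceil>2 ^ k * x $ i\<rceil> \<le> (2 ^ k :: real)" "of_int \<lfloor>2 ^ k * x $ i\<rfloor> \<le> (2 ^ k :: real)"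
    "0 \<le> (of_int \<lceil>2 ^ k * x $ i\<rceil> :: real)" "0 \<le> (of_int \<lfloor>2 ^ k * x $ i\<rfloor> :: real)" for i
    by (metis of_int_le_iff of_int_numeral of_int_power of_int_0)+
  then show ?thesis by (auto simp: grid_def mem_box_cart corner_def)
qed

text \<open>Applied to t = 2^k v_i with v on grid k + 1: the coordinate is either on the coarser
  grid or the midpoint of one of its intervals.\<close>

lemma half_integer_cases:
  fixes t :: real
  assumes "2 * t \<in> \<int>"
  obtains "of_int \<lceil>t\<rceil> = t" "of_int \<lfloor>t\<rfloor> = t"
    | "t = of_int \<lfloor>t\<rfloor> + 1 / 2" "\<lceil>t\<rceil> = \<lfloor>t\<rfloor> + 1"
proof -
  obtain z :: int where z: "2 * t = of_int z" using assms by (auto elim: Ints_cases)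
  show ?thesis
  proof (cases "even z")
    case True
    then obtain y where "z = 2 * y" by blast
    then have "t = of_int y" using z by simp
    then show ?thesis using that(1) by simp
  next
    case False
    then obtain y where "z = 2 * y + 1" by (elim oddE)
    then have t: "t = of_int y + 1 / 2" using z by simp
    then have "\<lfloor>t\<rfloor> = y" "\<lceil>t\<rceil> = y + 1" by linarith+
    then show ?thesis using that(2) t by simp
  qed
qed

text \<open>The function s -> max 0 (n - |s|) has kinks only at the integers -n, 0 and n, hence is
  affine on [w, w+1] and takes the mean of the end values at the midpoint. The four cases are the
  affine pieces.\<close>

lemma tent_midpoint_int:
  fixes w n :: int
  assumes "0 \<le> n"
  shows "max 0 (of_int n - \<bar>of_int w + 1 / 2\<bar>) =
    (max 0 (of_int n - \<bar>of_int (w + 1)\<bar>) + max 0 (of_int n - \<bar>of_int w\<bar>) :: real) / 2"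
proof -
  consider "0 \<le> w" "n \<le> w" | "0 \<le> w" "w + 1 \<le> n" | "w \<le> - 1" "n \<le> - w - 1" | "w \<le> - 1" "- w \<le> n"
    by linarith
  then have "(0 \<le> (of_int w :: real) \<and> (of_int n :: real) \<le> of_int w) \<or>
    (0 \<le> (of_int w :: real) \<and> (of_int w + 1 :: real) \<le> of_int n) \<or>
    ((of_int w :: real) \<le> - 1 \<and> (of_int n :: real) \<le> - of_int w - 1) \<or>
    ((of_int w :: real) \<le> - 1 \<and> - (of_int w :: real) \<le> of_int n)"
    by cases linarith+
  moreover have "0 \<le> (of_int n :: real)" using assms by simp
  ultimately show ?thesis by (auto simp: max_def abs_if)
qed

text \<open>A tent of level l \<le> k breaks only at level-l grid points, so it is affine between
  neighbouring level-k points.\<close>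

lemma tent_refine:
  assumes t: "2 ^ Suc k * t \<in> \<int>" and b: "2 ^ l * b \<in> \<int>" and "l \<le> k"
  shows "tent l b t = (tent l b (of_int \<lceil>2 ^ k * t\<rceil> / 2 ^ k) + tent l b (of_int \<lfloor>2 ^ k * t\<rfloor> / 2 ^ k)) / 2"
proof -
  have "2 * (2 ^ k * t) \<in> \<int>" using t by (simp add: mult.assoc)
  then show ?thesis
  proof (cases rule: half_integer_cases)
    case 1
    show ?thesis unfolding 1 by simp
  next
    case 2
    \<comment> \<open>Everything is rescaled to level-k steps: the tent then has half-width n and
      height n, and its centre is the integer n * J.\<close>
    define n :: int where "n = 2 ^ (k - l)"
    have n: "n > 0" "2 ^ k = of_int n * (2 ^ l :: real)"
      using \<open>l \<le> k\<close> by (auto simp: n_def simp flip: power_add)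
    obtain J :: int where J: "2 ^ l * b = of_int J" using b by (auto elim: Ints_cases)
    define w where "w = \<lfloor>2 ^ k * t\<rfloor> - n * J"
    have tent: "of_int n * tent l b (s / 2 ^ k) = max 0 (of_int n - \<bar>s - of_int (n * J)\<bar>)" for s
    proof -
      have "2 ^ l * \<bar>s / 2 ^ k - b\<bar> = \<bar>2 ^ l * (s / 2 ^ k - b)\<bar>" by (simp add: abs_mult)
      also have "2 ^ l * (s / 2 ^ k - b) = s / of_int n - of_int J"
        using n J by (simp add: right_diff_distrib)
      finally have "of_int n * (1 - 2 ^ l * \<bar>s / 2 ^ k - b\<bar>) = of_int n - of_int n * \<bar>s / of_int n - of_int J\<bar>"
        by (simp add: right_diff_distrib)
      also have "of_int n * \<bar>s / of_int n - of_int J\<bar> = \<bar>of_int n * (s / of_int n - of_int J)\<bar>"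
        using n by (simp add: abs_mult)
      also have "of_int n * (s / of_int n - of_int J) = s - of_int (n * J)"
        using n by (simp add: right_diff_distrib)
      finally show ?thesis using n by (simp add: tent_def max_mult_distrib_left)
    qed
    have "t = (of_int \<lfloor>2 ^ k * t\<rfloor> + 1 / 2) / 2 ^ k" using 2 by (simp add: field_simps)
    then have "of_int n * tent l b t = of_int n * tent l b ((of_int \<lfloor>2 ^ k * t\<rfloor> + 1 / 2) / 2 ^ k)" by simp
    also have "\<dots> = max 0 (of_int n - \<bar>of_int w + 1 / 2\<bar>)"
      unfolding tent by (simp add: w_def algebra_simps)
    also have "\<dots> = (max 0 (of_int n - \<bar>of_int (w + 1)\<bar>) + max 0 (of_int n - \<bar>of_int w\<bar>)) / 2"
      using n by (intro tent_midpoint_int) simp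
    also have "\<dots> = (of_int n * tent l b (of_int \<lceil>2 ^ k * t\<rceil> / 2 ^ k) + of_int n * tent l b (of_int \<lfloor>2 ^ k * t\<rfloor> / 2 ^ k)) / 2"
      unfolding tent 2(2) by (simp add: w_def algebra_simps)
    also have "\<dots> = of_int n * ((tent l b (of_int \<lceil>2 ^ k * t\<rceil> / 2 ^ k) + tent l b (of_int \<lfloor>2 ^ k * t\<rfloor> / 2 ^ k)) / 2)"
      by (simp add: field_simps)
    finally show ?thesis using n by simp
  qed
qed

text \<open>Expanding the product of the one-dimensional means gives one term for each set of
  coordinates rounded up, that is, for each corner.\<close>

lemma hat_refine:
  fixes u v :: "real ^ 'd"
  assumes v: "v \<in> grid (Suc k)" and u: "u \<in> grid l" and "l \<le> k"
  shows "hat l u v = (\<Sum>S\<in>UNIV. hat l u (corner k v S)) / 2 ^ CARD('d)"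
proof -
  let ?f = "\<lambda>i. tent l (u $ i) (of_int \<lceil>2 ^ k * v $ i\<rceil> / 2 ^ k)"
  let ?g = "\<lambda>i. tent l (u $ i) (of_int \<lfloor>2 ^ k * v $ i\<rfloor> / 2 ^ k)"
  have "hat l u v = (\<Prod>i\<in>UNIV. (?f i + ?g i) / 2)"
    unfolding hat_def
    by (intro prod.cong refl tent_refine) (use u v \<open>l \<le> k\<close> in \<open>auto simp: grid_def\<close>)
  also have "\<dots> = (\<Prod>i\<in>UNIV. ?f i + ?g i) / 2 ^ CARD('d)"
    by (simp add: prod_dividef)
  also have "(\<Prod>i\<in>UNIV. ?f i + ?g i) = (\<Sum>S\<in>Pow UNIV. prod ?f S * prod ?g (UNIV - S))"
    by (rule prod_add) simp
  also have "\<dots> = (\<Sum>S\<in>UNIV. hat l u (corner k v S))"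
  proof (rule sum.cong)
    fix S :: "'d set"
    have "hat l u (corner k v S) = (\<Prod>i\<in>UNIV. if i \<in> S then ?f i else ?g i)"
      unfolding hat_def corner_def by (intro prod.cong) auto
    also have "\<dots> = prod ?f (UNIV \<inter> S) * prod ?g (UNIV \<inter> - S)"
      by (simp add: prod.If_cases Collect_neg_eq)
    finally show "prod ?f S * prod ?g (UNIV - S) = hat l u (corner k v S)"
      by (simp add: Compl_eq_Diff_UNIV)
  qed auto
  finally show ?thesis .
qed

section \<open>Size, locality and Lipschitz constant of the hats\<close>

lemma tent_bounds: "0 \<le> tent k b t" "tent k b t \<le> 1"
  by (auto simp: tent_def)

lemma hat_bounds: "0 \<le> hat k u x" "hat k u x \<le> 1"
  unfolding hat_def by (auto intro!: prod_nonneg prod_le_1 tent_bounds)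

text \<open>Distinct points of grid k differ by at least 2^-k in some coordinate, where the tent
  factor vanishes.\<close>

lemma hat_on_grid:
  assumes "u \<in> grid k" "x \<in> grid k"
  shows "hat k u x = (if u = x then 1 else 0)"
proof (cases "u = x")
  case False
  then obtain i where i: "u $ i \<noteq> x $ i" by (auto simp: vec_eq_iff)
  obtain a b :: int where ab: "2 ^ k * u $ i = of_int a" "2 ^ k * x $ i = of_int b"
    using assms unfolding grid_def by (auto elim!: Ints_cases) (metis Ints_cases)
  have "2 ^ k * u $ i \<noteq> 2 ^ k * x $ i" using i by simp
  then have "a \<noteq> b" using ab by auto
  then have "1 \<le> \<bar>of_int b - (of_int a :: real)\<bar>" by (simp flip: of_int_diff of_int_abs)
  also have "\<dots> = 2 ^ k * \<bar>x $ i - u $ i\<bar>"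
    unfolding ab[symmetric] by (simp add: abs_mult flip: right_diff_distrib)
  finally have "tent k (u $ i) (x $ i) = 0" by (simp add: tent_def)
  then have "hat k u x = 0" unfolding hat_def by (intro prod_zero) auto
  then show ?thesis using False by simp
qed (simp add: hat_def tent_def)

text \<open>For factors in [0,1] the change of a product is at most the sum of the changes of the
  factors, so the l_1 distance enters without a dimensional constant.\<close>

lemma hat_lipschitz: "\<bar>hat k u x - hat k u y\<bar> \<le> 2 ^ k * l1_norm (x - y)"
proof -
  have "\<bar>hat k u x - hat k u y\<bar> \<le> (\<Sum>i\<in>UNIV. \<bar>tent k (u $ i) (x $ i) - tent k (u $ i) (y $ i)\<bar>)"
    using norm_prod_diff[of UNIV "\<lambda>i. tent k (u $ i) (x $ i)" "\<lambda>i. tent k (u $ i) (y $ i)"] tent_bounds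
    by (simp add: hat_def)
  also have "\<dots> \<le> (\<Sum>i\<in>UNIV. 2 ^ k * \<bar>x $ i - y $ i\<bar>)"
  proof (rule sum_mono)
    fix i
    have "\<bar>max 0 (1 - a) - max 0 (1 - b)\<bar> \<le> \<bar>a - b\<bar>" for a b :: real by (auto simp: max_def)
    then have "\<bar>tent k (u $ i) (x $ i) - tent k (u $ i) (y $ i)\<bar>
        \<le> \<bar>2 ^ k * \<bar>x $ i - u $ i\<bar> - 2 ^ k * \<bar>y $ i - u $ i\<bar>\<bar>"
      unfolding tent_def .
    also have "\<dots> = 2 ^ k * \<bar>\<bar>x $ i - u $ i\<bar> - \<bar>y $ i - u $ i\<bar>\<bar>"
      by (simp add: abs_mult flip: right_diff_distrib)
    also have "\<dots> \<le> 2 ^ k * \<bar>x $ i - y $ i\<bar>" by (intro mult_left_mono) auto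
    finally show "\<bar>tent k (u $ i) (x $ i) - tent k (u $ i) (y $ i)\<bar> \<le> 2 ^ k * \<bar>x $ i - y $ i\<bar>" .
  qed
  also have "\<dots> = 2 ^ k * l1_norm (x - y)" by (simp add: l1_norm_def sum_distrib_left)
  finally show ?thesis .
qed

text \<open>An integer at distance strictly less than 1 from a real number is its floor or its
  ceiling. Hence at most 2^d hats of one level are nonzero at a given point.\<close>

lemma hat_support:
  fixes x :: "real ^ 'd"
  assumes "u \<in> grid k" "hat k u x \<noteq> 0"
  shows "u \<in> range (corner k x)"
proof -
  define S where "S = {i. 2 ^ k * u $ i = of_int \<lceil>2 ^ k * x $ i\<rceil>}"
  have "2 ^ k * u $ i = of_int (if i \<in> S then \<lceil>2 ^ k * x $ i\<rceil> else \<lfloor>2 ^ k * x $ i\<rfloor>)" for i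
  proof -
    have "tent k (u $ i) (x $ i) \<noteq> 0" using assms(2) by (simp add: hat_def)
    then have "2 ^ k * \<bar>x $ i - u $ i\<bar> < 1" by (auto simp: tent_def max_def split: if_splits)
    moreover have "2 ^ k * \<bar>x $ i - u $ i\<bar> = \<bar>2 ^ k * x $ i - 2 ^ k * u $ i\<bar>"
      by (simp add: abs_mult flip: right_diff_distrib)
    moreover obtain a :: int where a: "2 ^ k * u $ i = of_int a"
      using assms(1) unfolding grid_def by (auto elim: Ints_cases)
    ultimately have "\<bar>2 ^ k * x $ i - of_int a\<bar> < 1" by simp
    then have "a = \<lceil>2 ^ k * x $ i\<rceil> \<or> a = \<lfloor>2 ^ k * x $ i\<rfloor>" by linarith
    then show ?thesis using a by (auto simp: S_def)
  qed
  then have "u $ i = corner k x S $ i" for i by (simp add: corner_def nonzero_eq_divide_eq mult.commute)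
  then have "u = corner k x S" by (simp add: vec_eq_iff)
  then show ?thesis by blast
qed

lemma hat_powr_sum_le:
  fixes x y :: "real ^ 'd"
  assumes G: "finite G" "G \<subseteq> grid k" and p: "0 < p"
  shows "(\<Sum>u\<in>G. \<bar>hat k u x - hat k u y\<bar> powr p) \<le> 2 * 2 ^ CARD('d) * min 1 (2 ^ k * l1_norm (x - y)) powr p"
proof -
  let ?H = "{u \<in> G. hat k u x \<noteq> 0 \<or> hat k u y \<noteq> 0}" and ?R = "\<lambda>x. range (corner k x)"
  have fin: "finite (?R x)" and card: "card (?R x) \<le> 2 ^ CARD('d)" for x :: "real ^ 'd"
  proof -
    have "card (UNIV :: 'd set set) = 2 ^ CARD('d)" by (simp flip: Pow_UNIV add: card_Pow)
    then show "card (?R x) \<le> 2 ^ CARD('d)" using card_image_le[of UNIV "corner k x"] by simp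
  qed simp
  have "?H \<subseteq> ?R x \<union> ?R y" using hat_support G by blast
  then have "card ?H \<le> card (?R x \<union> ?R y)" using fin by (intro card_mono) auto
  also have "\<dots> \<le> card (?R x) + card (?R y)" by (rule card_Un_le)
  also have "\<dots> \<le> 2 * 2 ^ CARD('d)" using card[of x] card[of y] by simp
  finally have H: "real (card ?H) \<le> real (2 * 2 ^ CARD('d))" by (simp only: of_nat_le_iff)
  have "(\<Sum>u\<in>G. \<bar>hat k u x - hat k u y\<bar> powr p) = (\<Sum>u\<in>?H. \<bar>hat k u x - hat k u y\<bar> powr p)"
    using G by (intro sum.mono_neutral_right) auto
  also have "\<dots> \<le> (\<Sum>u\<in>?H. min 1 (2 ^ k * l1_norm (x - y)) powr p)"
  proof (rule sum_mono)
    fix u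
    have "\<bar>hat k u x - hat k u y\<bar> \<le> 1" using hat_bounds[of k u x] hat_bounds[of k u y] by auto
    then show "\<bar>hat k u x - hat k u y\<bar> powr p \<le> min 1 (2 ^ k * l1_norm (x - y)) powr p"
      using hat_lipschitz[of k u x y] p by (intro powr_mono2) auto
  qed
  also have "\<dots> = real (card ?H) * min 1 (2 ^ k * l1_norm (x - y)) powr p" by simp
  also have "\<dots> \<le> real (2 * 2 ^ CARD('d)) * min 1 (2 ^ k * l1_norm (x - y)) powr p"
    using H by (intro mult_right_mono) auto
  finally show ?thesis by simp
qed

section \<open>Distances from points to their corners\<close>

lemma l1_norm_nonneg: "0 \<le> l1_norm x"
  by (simp add: l1_norm_def sum_nonneg)

lemma l1_norm_pos: "x \<noteq> 0 \<Longrightarrow> 0 < l1_norm x"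
  unfolding l1_norm_def vec_eq_iff by (auto intro: sum_pos2)

lemma l1_norm_le:
  fixes x :: "real ^ 'd" and r :: real
  assumes "\<And>i. \<bar>x $ i\<bar> \<le> r"
  shows "l1_norm x \<le> real CARD('d) * r"
  unfolding l1_norm_def using sum_mono[of UNIV "\<lambda>i. \<bar>x $ i\<bar>" "\<lambda>_. r"] assms by simp

text \<open>On the next finer grid a coordinate is a coarse grid value or a midpoint, so rounding
  moves it by at most half the coarse mesh. This is the mesh of level k + 1, the scale on which
  \<open>weight\<close> is based for points of that level.\<close>

lemma corner_dist:
  assumes "v \<in> grid (Suc k)"
  shows "\<bar>(v - corner k v S) $ i\<bar> \<le> 1 / 2 ^ Suc k"
proof -
  have "2 * (2 ^ k * v $ i) \<in> \<int>" using assms by (simp add: grid_def mult.assoc)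
  then have "\<bar>2 ^ k * v $ i - of_int (if i \<in> S then \<lceil>2 ^ k * v $ i\<rceil> else \<lfloor>2 ^ k * v $ i\<rfloor>)\<bar> \<le> 1 / 2"
    by (cases rule: half_integer_cases) auto
  then have "\<bar>2 ^ k * (v - corner k v S) $ i\<bar> \<le> 1 / 2"
    by (simp add: corner_def right_diff_distrib)
  then show ?thesis unfolding abs_mult by (simp add: field_simps)
qed

text \<open>For arbitrary points only the full mesh is available as a bound; this serves to
  approximate non-dyadic points.\<close>

lemma corner_approx: "\<bar>(x - corner k x {}) $ i\<bar> \<le> 1 / 2 ^ k"
proof -
  have "\<bar>2 ^ k * x $ i - of_int \<lfloor>2 ^ k * x $ i\<rfloor>\<bar> \<le> 1" by linarith
  then have "\<bar>2 ^ k * (x - corner k x {}) $ i\<bar> \<le> 1"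
    by (simp add: corner_def right_diff_distrib)
  then show ?thesis unfolding abs_mult by (simp add: field_simps)
qed

section \<open>Linear extension and geometric sums\<close>

text \<open>The pairing of h with the finitely supported measure m. If h vanishes at the base point,
  it is the linear extension of \<delta>(x) -> h x.\<close>

definition lin_ext :: "('a \<Rightarrow> real) \<Rightarrow> ('a \<Rightarrow> real) \<Rightarrow> real" where
  "lin_ext h m = (\<Sum>t | m t \<noteq> 0. m t * h t)"

lemma lin_ext_superset:
  assumes "finite A" "{t. m t \<noteq> 0} \<subseteq> A"
  shows "lin_ext h m = (\<Sum>t\<in>A. m t * h t)"
  unfolding lin_ext_def using assms by (intro sum.mono_neutral_left) auto

lemma lin_ext_sum:
  assumes "finite I" "\<And>i. i \<in> I \<Longrightarrow> finite {t. f i t \<noteq> 0}"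
  shows "lin_ext h (\<lambda>t. \<Sum>i\<in>I. c i * f i t) = (\<Sum>i\<in>I. c i * lin_ext h (f i))"
proof -
  let ?A = "\<Union>i\<in>I. {t. f i t \<noteq> 0}"
  have A: "finite ?A" using assms by auto
  have "lin_ext h (\<lambda>t. \<Sum>i\<in>I. c i * f i t) = (\<Sum>t\<in>?A. (\<Sum>i\<in>I. c i * f i t) * h t)"
    using A by (intro lin_ext_superset) (auto intro!: sum.neutral elim!: sum.not_neutral_contains_not_neutral)
  also have "\<dots> = (\<Sum>i\<in>I. c i * (\<Sum>t\<in>?A. f i t * h t))"
    by (subst sum.swap[of _ ?A I] | simp add: sum_distrib_left sum_distrib_right mult.assoc)+
  also have "\<dots> = (\<Sum>i\<in>I. c i * lin_ext h (f i))"
    using A by (intro sum.cong refl arg_cong2[where f="(*)"] lin_ext_superset[symmetric]) auto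
  finally show ?thesis .
qed

lemma lin_ext_add:
  assumes "finite {t. f t \<noteq> 0}" "finite {t. g t \<noteq> 0}"
  shows "lin_ext h (f + g) = lin_ext h f + lin_ext h g"
proof -
  let ?A = "{t. f t \<noteq> 0} \<union> {t. g t \<noteq> 0}"
  have "lin_ext h (f + g) = (\<Sum>t\<in>?A. (f + g) t * h t)"
    by (rule lin_ext_superset) (use assms in auto)
  moreover have "lin_ext h f = (\<Sum>t\<in>?A. f t * h t)" "lin_ext h g = (\<Sum>t\<in>?A. g t * h t)"
    using assms by (auto intro!: lin_ext_superset)
  ultimately show ?thesis by (simp add: distrib_right sum.distrib)
qed

lemma lin_ext_scale:
  assumes "finite {t. f t \<noteq> 0}"
  shows "lin_ext h (\<lambda>t. c * f t) = c * lin_ext h f"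
  using lin_ext_sum[of "{()}" "\<lambda>_. f" h "\<lambda>_. c"] assms by simp

lemma finite_support_delta: "finite {t. delta z x t \<noteq> 0}"
  by (rule finite_subset[of _ "{x}"]) (auto simp: delta_def)

lemma lin_ext_delta: "h z = 0 \<Longrightarrow> lin_ext h (delta z x) = h x"
  by (subst lin_ext_superset[of "{x}"]) (auto simp: delta_def)

lemma finite_support_delta_diff: "finite {t. delta z x t - delta z y t \<noteq> 0}"
  by (rule finite_subset[of _ "{x, y}"]) (auto simp: delta_def)

lemma lin_ext_delta_diff: "h z = 0 \<Longrightarrow> lin_ext h (\<lambda>t. delta z x t - delta z y t) = h x - h y"
  using lin_ext_add[of "delta z x" "\<lambda>t. - 1 * delta z y t" h] lin_ext_scale[of "delta z y" h "- 1"]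
  by (simp add: finite_support_delta lin_ext_delta plus_fun_def)

text \<open>Levels are indexed by their distance from a cutoff level. Distinct levels have distinct
  exponents, so the full geometric series dominates.\<close>

lemma sum_power_inj_le:
  fixes q :: real
  assumes "finite I" "inj_on f I" "0 \<le> q" "q < 1"
  shows "(\<Sum>k\<in>I. q ^ f k) \<le> 1 / (1 - q)"
proof -
  have "(\<Sum>k\<in>I. q ^ f k) = (\<Sum>j\<in>f ` I. q ^ j)"
    using assms(2) by (simp add: sum.reindex)
  also have "\<dots> \<le> (\<Sum>j. q ^ j)"
    using assms by (intro sum_le_suminf summable_geometric) auto
  also have "\<dots> = 1 / (1 - q)" using assms by (intro suminf_geometric) auto
  finally show ?thesis .
qed

lemma two_powr_power: "(2 powr a) ^ k = (2 ^ k) powr (a :: real)"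
  by (simp add: powr_powr mult.commute flip: powr_realpow)

text \<open>The levels split according to whether 2^k t \<le> 1. In each group the terms decay
  geometrically away from the cutoff, with ratio 2^(-p \<alpha>) on the fine side and 2^(p (\<alpha>
  - 1)) on the coarse side; the term nearest the cutoff is at most t^(p \<alpha>).\<close>

lemma sum_min_power_le:
  fixes p \<alpha> t :: real
  assumes "0 < p" "0 < \<alpha>" "\<alpha> < 1" "0 < t" "finite I"
  shows "(\<Sum>k\<in>I. (2 powr (- p * \<alpha>)) ^ k * min 1 (2 ^ k * t) powr p)
    \<le> (1 / (1 - 2 powr (- p * \<alpha>)) + 1 / (1 - 2 powr (p * (\<alpha> - 1)))) * t powr (p * \<alpha>)"
proof -
  define q where "q = 2 powr (- p * \<alpha>)"
  define s where "s = 2 powr (p * (\<alpha> - 1))"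
  have q: "0 \<le> q" "q < 1" unfolding q_def using assms by (auto intro: powr_less_one)
  have s: "0 \<le> s" "s < 1" unfolding s_def using assms by (auto intro!: powr_less_one mult_pos_neg)
  let ?c = "\<lambda>k. q ^ k * min 1 (2 ^ k * t) powr p"
  let ?L = "{k\<in>I. 2 ^ k * t \<le> 1}" and ?H = "{k\<in>I. \<not> 2 ^ k * t \<le> 1}"
  have "(\<Sum>k\<in>?H. ?c k) \<le> 1 / (1 - q) * t powr (p * \<alpha>)"
  proof (cases "?H = {}")
    case False
    \<comment> \<open>The coarsest level with 2^m t > 1; there q^m = (2^-m)^(p \<alpha>) is already
      below t^(p \<alpha>).\<close>
    define m where "m = Min ?H"
    have m: "m \<in> ?H" "\<And>k. k \<in> ?H \<Longrightarrow> m \<le> k"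
      unfolding m_def using False assms(5) by (auto simp del: mem_Collect_eq)
    have "1 / 2 ^ m \<le> t" using m(1) by (simp add: field_simps)
    then have "(1 / 2 ^ m) powr (p * \<alpha>) \<le> t powr (p * \<alpha>)" using assms by (intro powr_mono2) auto
    moreover have "(1 / 2 ^ m) powr (p * \<alpha>) = q ^ m"
      unfolding q_def two_powr_power by (simp add: powr_minus_divide powr_divide)
    ultimately have qm: "q ^ m \<le> t powr (p * \<alpha>)" by simp
    have "(\<Sum>k\<in>?H. ?c k) \<le> (\<Sum>k\<in>?H. t powr (p * \<alpha>) * q ^ (k - m))"
    proof (rule sum_mono)
      fix k assume k: "k \<in> ?H"
      have "?c k = q ^ m * q ^ (k - m)" using k m(2)[OF k] by (simp add: min_def flip: power_add)
      also have "\<dots> \<le> t powr (p * \<alpha>) * q ^ (k - m)" using qm q by (intro mult_right_mono) auto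
      finally show "?c k \<le> t powr (p * \<alpha>) * q ^ (k - m)" .
    qed
    also have "\<dots> = t powr (p * \<alpha>) * (\<Sum>k\<in>?H. q ^ (k - m))" by (simp add: sum_distrib_left)
    also have "\<dots> \<le> t powr (p * \<alpha>) * (1 / (1 - q))"
    proof (intro mult_left_mono sum_power_inj_le)
      show "inj_on (\<lambda>k. k - m) ?H" using m(2) by (intro inj_onI) (metis diff_add le_add_diff_inverse2)
    qed (use assms q in auto)
    finally show ?thesis by (simp add: mult.commute)
  qed (use q in \<open>simp del: Collect_empty_eq\<close>)
  moreover have "(\<Sum>k\<in>?L. ?c k) \<le> 1 / (1 - s) * t powr (p * \<alpha>)"
  proof (cases "?L = {}")
    case False
    \<comment> \<open>The finest level with 2^m t \<le> 1, so a level k below it satisfies 2^k t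
      \<le> 2^-(m-k).\<close>
    define m where "m = Max ?L"
    have m: "m \<in> ?L" "\<And>k. k \<in> ?L \<Longrightarrow> k \<le> m"
      unfolding m_def using False assms(5) by (auto simp del: mem_Collect_eq)
    have "(\<Sum>k\<in>?L. ?c k) \<le> (\<Sum>k\<in>?L. t powr (p * \<alpha>) * s ^ (m - k))"
    proof (rule sum_mono)
      fix k assume k: "k \<in> ?L"
      have "?c k = (2 ^ k) powr (- p * \<alpha>) * (2 ^ k * t) powr p"
        using k by (simp add: min_absorb2 q_def two_powr_power)
      \<comment> \<open>Splitting p as p \<alpha> + p (1 - \<alpha>): the first part cancels the
        weight and leaves t^(p \<alpha>), the second provides the geometric decay.\<close>
      also have "(2 ^ k * t) powr p = (2 ^ k * t) powr (p * \<alpha>) * (2 ^ k * t) powr (p * (1 - \<alpha>))"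
        by (simp add: algebra_simps flip: powr_add)
      also have "(2 ^ k) powr (- p * \<alpha>) * ((2 ^ k * t) powr (p * \<alpha>) * (2 ^ k * t) powr (p * (1 - \<alpha>)))
          = t powr (p * \<alpha>) * (2 ^ k * t) powr (p * (1 - \<alpha>))"
        by (simp add: powr_mult powr_minus)
      also have "\<dots> \<le> t powr (p * \<alpha>) * (1 / 2 ^ (m - k)) powr (p * (1 - \<alpha>))"
      proof (intro mult_left_mono powr_mono2)
        have "2 ^ (m - k) * (2 ^ k * t) \<le> 1"
          using m(1) m(2)[OF k] by (simp flip: mult.assoc power_add)
        then show "2 ^ k * t \<le> 1 / 2 ^ (m - k)" by (simp add: field_simps)
      qed (use assms in auto)
      also have "(1 / 2 ^ (m - k)) powr (p * (1 - \<alpha>)) = (2 ^ (m - k)) powr (- (p * (1 - \<alpha>)))"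
        by (simp add: powr_minus_divide powr_divide)
      also have "- (p * (1 - \<alpha>)) = p * (\<alpha> - 1)" by (simp add: algebra_simps)
      also have "(2 ^ (m - k)) powr (p * (\<alpha> - 1)) = s ^ (m - k)"
        by (simp add: s_def two_powr_power)
      finally show "?c k \<le> t powr (p * \<alpha>) * s ^ (m - k)" .
    qed
    also have "\<dots> = t powr (p * \<alpha>) * (\<Sum>k\<in>?L. s ^ (m - k))" by (simp add: sum_distrib_left)
    also have "\<dots> \<le> t powr (p * \<alpha>) * (1 / (1 - s))"
    proof (intro mult_left_mono sum_power_inj_le)
      show "inj_on (\<lambda>k. m - k) ?L" using m(2) by (intro inj_onI) (metis diff_diff_cancel)
    qed (use assms s in auto)
    finally show ?thesis by (simp add: mult.commute)
  qed (use s in \<open>simp del: Collect_empty_eq\<close>)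
  moreover have "(\<Sum>k\<in>I. ?c k) = (\<Sum>k\<in>?L. ?c k) + (\<Sum>k\<in>?H. ?c k)"
    using assms(5) by (subst sum.union_disjoint[symmetric]) (auto intro!: sum.cong)
  ultimately show ?thesis by (simp add: q_def s_def algebra_simps)
qed

text \<open>
  The claimed constant has room to spare: \<open>p * \<alpha> < 1\<close> gives \<open>2 powr (- p * \<alpha>) \<ge> 1 / 2\<close>, so that
  \<open>rho powr p \<ge> 3\<close>, while \<open>tau powr p \<ge> 4 * A * B\<close>.
\<close>

lemma distortion_le_constant:
  fixes p \<alpha> :: real
  assumes \<alpha>: "0 < \<alpha>" "\<alpha> < 1" and p: "0 < p" "p \<le> 1" and d: "1 \<le> d"
  defines "A \<equiv> 1 / (1 - 2 powr (- p * \<alpha>))" and "B \<equiv> 1 / (1 - 2 powr (p * (\<alpha> - 1)))"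
  shows "(2 * 2 ^ d * (A + B)) powr (1 / p) * (2 powr (real d * (1 - p)) * real d powr (p * \<alpha>)) powr (1 / p)
    \<le> Cconst p (2 ^ d) * rho p \<alpha> ^ d * tau d p \<alpha> ^ d"
proof -
  define q where "q = 2 powr (- p * \<alpha>)"
  have p\<alpha>: "0 < p * \<alpha>" "p * \<alpha> < 1" using \<alpha> p by (auto intro: le_less_trans[OF mult_right_mono[of p 1 \<alpha>]])
  have q: "1 / 2 \<le> q" "q < 1" unfolding q_def using p\<alpha> powr_mono[of "-1" "- p * \<alpha>" 2]
      powr_less_mono[of "- p * \<alpha>" 0 2]
    by (auto simp: powr_minus)
  have AB: "1 \<le> A" "1 \<le> B"
  proof -
    have "2 powr (p * (\<alpha> - 1)) < 1" using \<alpha> p by (auto intro!: powr_less_one mult_pos_neg)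
    then show "1 \<le> B" by (simp add: B_def)
    show "1 \<le> A" using q by (simp add: A_def q_def)
  qed
  define R where "R = rho p \<alpha> powr p"
  have R: "3 \<le> R"
  proof -
    have one: "1 \<le> 2 powr (1 - p)" using p by (intro ge_one_powr_ge_zero) auto
    have "Cconst p 2 powr p = 2 powr (1 - p)"
      using p by (simp add: Cconst_def powr_powr algebra_simps)
    moreover have "q * A = q / (1 - q)" by (simp add: A_def q_def)
    then have "1 \<le> q * A" using q by (simp add: le_divide_eq)
    then have "2 * 1 \<le> (1 + 2 powr (1 - p)) * (q * A)" using one by (intro mult_mono) auto
    ultimately have "3 \<le> Cconst p 2 powr p + (1 + 2 powr (1 - p)) * q * A"
      using one by (simp add: mult.assoc)
    then show ?thesis using p by (simp add: R_def rho_def powr_powr A_def q_def)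
  qed
  define U where "U = tau d p \<alpha> powr p"
  have U: "4 * (A * B) \<le> U"
  proof -
    have e: "(1 / p - \<alpha>) * p = 1 - p * \<alpha>" using p by (simp add: field_simps)
    have "Cconst (p * \<alpha>) d powr \<alpha> = real d powr ((1 / (p * \<alpha>) - 1) * \<alpha>)"
      by (simp add: Cconst_def powr_powr)
    also have "(1 / (p * \<alpha>) - 1) * \<alpha> = 1 / p - \<alpha>" using p \<alpha> by (simp add: field_simps)
    finally have C: "(Cconst (p * \<alpha>) d powr \<alpha>) powr p = real d powr (1 - p * \<alpha>)"
      using e by (simp add: powr_powr)
    have "U = real d powr (1 - p * \<alpha>) * 4 * B * A * (1 + (real d - 1) powr (p * \<alpha>))"
    proof -
      have root: "(x powr (1 / p)) powr p = x" if "0 \<le> x" for x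
        using that p by (simp add: powr_powr)
      have four: "(2 powr (2 / p)) powr p = 4" using p by (simp add: powr_powr)
      show ?thesis
        unfolding U_def tau_def A_def[symmetric] B_def[symmetric] powr_mult C four
        using AB by (simp add: root del: powr_powr)
    qed
    moreover have "1 \<le> real d powr (1 - p * \<alpha>)" using d p\<alpha> by (intro ge_one_powr_ge_zero) auto
    then have "1 * 1 \<le> real d powr (1 - p * \<alpha>) * (1 + (real d - 1) powr (p * \<alpha>))"
      by (intro mult_mono) auto
    then have "4 * (A * B) * 1 \<le> 4 * (A * B) * (real d powr (1 - p * \<alpha>) * (1 + (real d - 1) powr (p * \<alpha>)))"
      using AB by (intro mult_left_mono) auto
    ultimately show ?thesis by (simp add: mult_ac)
  qed
  have AB1: "1 \<le> A * B" using AB mult_mono[of 1 A 1 B] by simp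
  \<comment> \<open>The target after collecting factors is 3^d * 4^d = 2^d * 6^d. The factor 2^d is
    the number of corners, so 6^d must absorb the remaining 4 d.\<close>
  have six: "4 * d \<le> 6 ^ d" using d
  proof (induction d rule: dec_induct)
    case (step n) then show ?case by simp
  qed simp
  have "2 * 2 ^ d * (A + B) * real d powr (p * \<alpha>) \<le> 2 * 2 ^ d * (2 * (A * B)) * real d"
  proof (intro mult_mono)
    \<comment> \<open>Expanding gives A + B \<le> A B + 1, and A B is at least 1.\<close>
    have "0 \<le> (A - 1) * (B - 1)" using AB by simp
    then show "A + B \<le> 2 * (A * B)" using AB1 by (simp add: algebra_simps)
    show "real d powr (p * \<alpha>) \<le> real d" using d p\<alpha> powr_mono[of "p * \<alpha>" 1 "real d"] by simp
  qed (use AB in auto)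
  also have "\<dots> = 2 ^ d * (A * B) * real (4 * d)" by simp
  also have "\<dots> \<le> 2 ^ d * (A * B) * real (6 ^ d)" using of_nat_mono[OF six] AB1 by (intro mult_left_mono) simp_all
  also have "\<dots> = 12 ^ d * (A * B) ^ 1" using power_mult_distrib[of "2 :: real" 6 d] by simp
  also have "\<dots> \<le> 12 ^ d * (A * B) ^ d" using AB1 d by (intro mult_left_mono power_increasing) auto
  also have "\<dots> = 3 ^ d * (4 * (A * B)) ^ d"
    using power_mult_distrib[of "3 :: real" 4 d] by (simp add: power_mult_distrib[of 4])
  also have "\<dots> \<le> R ^ d * U ^ d" using R U AB1 by (intro mult_mono power_mono) auto
  finally have main: "2 * 2 ^ d * (A + B) * real d powr (p * \<alpha>) \<le> R ^ d * U ^ d" .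
  have pw: "(x powr p) ^ d = (x ^ d) powr p" if "0 \<le> x" for x :: real
    using that by (cases "x = 0") (use p d in \<open>auto simp: powr_powr mult.commute zero_power simp flip: powr_realpow\<close>)
  have nn: "0 \<le> rho p \<alpha>" "0 \<le> tau d p \<alpha>" "0 \<le> Cconst p (2 ^ d)"
    by (simp_all add: rho_def tau_def Cconst_def)
  \<comment> \<open>The loss from averaging 2^d terms matches the factor C(p,2^d) of the claim
    exactly.\<close>
  have Cp: "2 powr (real d * (1 - p)) = Cconst p (2 ^ d) powr p"
    using p by (simp add: Cconst_def powr_powr algebra_simps flip: powr_realpow)
  have "2 * 2 ^ d * (A + B) * (2 powr (real d * (1 - p)) * real d powr (p * \<alpha>))
      = 2 powr (real d * (1 - p)) * (2 * 2 ^ d * (A + B) * real d powr (p * \<alpha>))" by simp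
  also have "\<dots> \<le> 2 powr (real d * (1 - p)) * (R ^ d * U ^ d)" using main by (intro mult_left_mono) auto
  also have "\<dots> = (Cconst p (2 ^ d) * rho p \<alpha> ^ d * tau d p \<alpha> ^ d) powr p"
    unfolding R_def U_def Cp pw[OF nn(1)] pw[OF nn(2)] by (simp add: powr_mult)
  finally have "(2 * 2 ^ d * (A + B) * (2 powr (real d * (1 - p)) * real d powr (p * \<alpha>))) powr (1 / p)
      \<le> ((Cconst p (2 ^ d) * rho p \<alpha> ^ d * tau d p \<alpha> ^ d) powr p) powr (1 / p)"
    using p AB by (intro powr_mono2) auto
  then show ?thesis using p nn by (simp add: powr_powr powr_mult)
qed

section \<open>The hierarchical basis of the cube\<close>

text \<open>
  \<open>\<delta>(v)\<close> minus its multilinear interpolation from the next coarser grid. A coordinate of \<open>v\<close>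
  lying on the coarser grid makes corners coincide, and averaging over all \<open>S\<close> with repetition
  gives the interpolation weights.
\<close>

definition schauder :: "real ^ 'd \<Rightarrow> real ^ 'd \<Rightarrow> real" where
  "schauder v = (\<lambda>t. if level v = 0 then delta 0 v t
     else \<Sum>S\<in>UNIV. 1 / 2 ^ CARD('d) * (delta 0 v t - delta 0 (corner (level v - 1) v S) t))"

lemma dyadic_ne_0: "v \<in> dyadic_points \<Longrightarrow> v \<noteq> 0"
  by (simp add: dyadic_points_eq)

lemma grid_in_cbox: "x \<in> grid k \<Longrightarrow> x \<in> cbox 0 1"
  by (simp add: grid_def)

lemma dyadic_in_cbox: "v \<in> dyadic_points \<Longrightarrow> v \<in> cbox 0 1"
  using in_grid_level grid_in_cbox by blast

lemma hat_level_0: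
  assumes "u \<in> dyadic_points" shows "hat (level u) u 0 = 0"
  using hat_on_grid[OF in_grid_level[OF assms] zero_in_grid] dyadic_ne_0[OF assms] by simp

text \<open>If u has lower level than v, interpolation reproduces the hat and the pairing cancels.
  Otherwise, for v of positive level, v and its corners lie on the grid of u, where the hat is a
  Kronecker delta, and no corner equals u because corners have lower level than v. At level 0 the
  vector is just \<delta>(v).\<close>

lemma lin_ext_hat_schauder:
  fixes u v :: "real ^ 'd"
  assumes u: "u \<in> dyadic_points" and v: "v \<in> dyadic_points"
  shows "lin_ext (hat (level u) u) (schauder v) = (if u = v then 1 else 0)"
proof (cases "level v")
  case 0
  have v0: "v \<in> grid k" for k using in_grid_level[OF v] grid_mono[of 0 k] 0 by auto
  have "schauder v = delta 0 v" by (auto simp: schauder_def 0)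
  then show ?thesis using hat_on_grid[OF in_grid_level[OF u] v0] hat_level_0[OF u] by (simp add: lin_ext_delta)
next
  case (Suc k)
  let ?c = "\<lambda>S. corner k v S"
  have vk: "v \<in> grid (Suc k)" using in_grid_level[OF v] Suc by simp
  then have c: "?c S \<in> grid k" for S by (intro corner_in_grid grid_in_cbox)
  have "schauder v = (\<lambda>t. \<Sum>S\<in>UNIV. 1 / 2 ^ CARD('d) * (delta 0 v t - delta 0 (?c S) t))"
    unfolding schauder_def using Suc by simp
  then have "lin_ext (hat (level u) u) (schauder v) =
      (\<Sum>S\<in>UNIV. 1 / 2 ^ CARD('d) * (hat (level u) u v - hat (level u) u (?c S)))"
    by (simp only: lin_ext_sum finite finite_support_delta_diff hat_level_0[OF u] lin_ext_delta_diff)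
  also have "\<dots> = hat (level u) u v - (\<Sum>S\<in>UNIV. hat (level u) u (?c S)) / 2 ^ CARD('d)"
  proof -
    have "card (UNIV :: 'd set set) = 2 ^ CARD('d)" by (simp flip: Pow_UNIV add: card_Pow)
    then show ?thesis
      by (simp only: sum_distrib_left[symmetric] sum_subtractf sum_constant) (simp add: field_simps)
  qed
  also have "\<dots> = (if u = v then 1 else 0)"
  proof (cases "level u \<le> k")
    case True
    then have "u \<noteq> v" using Suc by auto
    then show ?thesis using hat_refine[OF vk in_grid_level[OF u] True] by simp
  next
    case False
    then have sub: "v \<in> grid (level u)" "?c S \<in> grid (level u)" for S
      using vk c[of S] grid_mono[of "Suc k" "level u"] grid_mono[of k "level u"] by auto
    have "u \<noteq> ?c S" for S using level_le[OF c[of S]] False by auto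
    then show ?thesis using hat_on_grid[OF in_grid_level[OF u] sub(1)] hat_on_grid[OF in_grid_level[OF u] sub(2)]
      by simp
  qed
  finally show ?thesis .
qed

text \<open>The p-th power of the bound on the coefficient map: 2 * 2^d active hats per level, times
  the geometric sums over levels fine and coarse relative to the distance of the two points.\<close>

definition upper_const :: "nat \<Rightarrow> real \<Rightarrow> real \<Rightarrow> real" where
  "upper_const d p \<alpha> =
    2 * 2 ^ d * (1 / (1 - 2 powr (- p * \<alpha>)) + 1 / (1 - 2 powr (p * (\<alpha> - 1))))"

text \<open>The p-th power of the bound on the inverse: 2^d corners of weight 2^-d each give 2^d *
  2^(-d p), and the distance d * 2^-k gives d^(p \<alpha>) once the weight is split off.\<close>

definition lower_const :: "nat \<Rightarrow> real \<Rightarrow> real \<Rightarrow> real" where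
  "lower_const d p \<alpha> = 2 powr (real d * (1 - p)) * real d powr (p * \<alpha>)"

section \<open>The coefficient map on the cube and its upper bound\<close>

locale cube_free_space =
  fixes p \<alpha> :: real and d_type :: "'d::finite itself"
  assumes \<alpha>: "0 < \<alpha>" "\<alpha> < 1" and p: "0 < p" "p \<le> 1"
begin

abbreviation "V \<equiv> dyadic_points :: (real ^ 'd) set"
abbreviation "\<sigma> \<equiv> \<lambda>x y :: real ^ 'd. l1_norm (x - y) powr \<alpha>"

sublocale F: free_pnormed p "cbox 0 1 :: (real ^ 'd) set" \<sigma> 0
proof
  show "0 < p" "p \<le> 1" by (fact p)+
  show "0 \<in> (cbox 0 1 :: (real ^ 'd) set)" by (simp add: mem_box_cart)
  fix x y :: "real ^ 'd" assume "x \<noteq> y"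
  then show "0 < \<sigma> x y" using l1_norm_pos[of "x - y"] by simp
qed

sublocale P: pnormed_fun_space F.P p by (rule F.pnormed)
sublocale L: pnormed_fun_space "lp_space p V" p by (rule pnormed_lp_space[OF p])

text \<open>The free norm of \<open>schauder v\<close> is at most a constant times this number, so
  \<open>schauder v\<close> divided by it is a normalized basis vector and the hat functional times
  it is the matching coordinate.\<close>

definition weight :: "real ^ 'd \<Rightarrow> real" where
  "weight v = 2 powr (- \<alpha> * real (level v))"

definition hat_coeffs :: "(real ^ 'd \<Rightarrow> real) \<Rightarrow> real ^ 'd \<Rightarrow> real" where
  "hat_coeffs m = (\<lambda>v. if v \<in> V then weight v * lin_ext (hat (level v) v) m else 0)"

text \<open>\<open>lin_ext\<close> with exchanged roles: g supplies the coefficients and t is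
  frozen, so linearity in g is inherited.\<close>

definition synth :: "(real ^ 'd \<Rightarrow> real) \<Rightarrow> real ^ 'd \<Rightarrow> real" where
  "synth g = (\<lambda>t. lin_ext (\<lambda>v. schauder v t / weight v) g)"

lemma upper_const_nonneg: "0 \<le> upper_const CARD('d) p \<alpha>"
proof -
  have "2 powr (- p * \<alpha>) < 1" "2 powr (p * (\<alpha> - 1)) < 1"
    using \<alpha> p by (auto intro!: powr_less_one mult_pos_neg)
  then show ?thesis unfolding upper_const_def by simp
qed

lemma lower_const_nonneg: "0 \<le> lower_const CARD('d) p \<alpha>"
  by (simp add: lower_const_def)

lemma weight_pos: "0 < weight v"
  by (simp add: weight_def)

lemma weight_powr: "weight v powr p = (2 powr (- p * \<alpha>)) ^ level v"
  by (simp add: weight_def powr_powr algebra_simps flip: powr_realpow)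

lemma sigma_powr: "\<sigma> x y powr p = l1_norm (x - y) powr (p * \<alpha>)"
  by (simp add: powr_powr mult.commute)

lemma carrier_finite: "m \<in> vcarrier F.P \<Longrightarrow> finite {t. m t \<noteq> 0}"
  by (simp add: F.carrier_iff)

lemma sum_hat_diff_le:
  fixes x y :: "real ^ 'd"
  assumes G: "finite G" "G \<subseteq> V"
  shows "(\<Sum>v\<in>G. (weight v * \<bar>hat (level v) v x - hat (level v) v y\<bar>) powr p)
    \<le> upper_const CARD('d) p \<alpha> * l1_norm (x - y) powr (p * \<alpha>)"
proof (cases "x = y")
  case False
  then have t: "0 < l1_norm (x - y)" by (intro l1_norm_pos) simp
  let ?q = "2 powr (- p * \<alpha>)" and ?m = "\<lambda>k. min 1 (2 ^ k * l1_norm (x - y)) powr p"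
  have "(\<Sum>v\<in>G. (weight v * \<bar>hat (level v) v x - hat (level v) v y\<bar>) powr p)
      = (\<Sum>v\<in>G. ?q ^ level v * \<bar>hat (level v) v x - hat (level v) v y\<bar> powr p)"
    by (simp add: powr_mult weight_powr)
  also have "\<dots> = (\<Sum>k\<in>level ` G. \<Sum>v\<in>{v \<in> G. level v = k}. ?q ^ level v * \<bar>hat (level v) v x - hat (level v) v y\<bar> powr p)"
    using G by (intro sum.group[symmetric]) auto
  also have "\<dots> \<le> (\<Sum>k\<in>level ` G. 2 * 2 ^ CARD('d) * (?q ^ k * ?m k))"
  proof (rule sum_mono)
    fix k
    have "(\<Sum>v\<in>{v \<in> G. level v = k}. ?q ^ level v * \<bar>hat (level v) v x - hat (level v) v y\<bar> powr p)
        = ?q ^ k * (\<Sum>v\<in>{v \<in> G. level v = k}. \<bar>hat k v x - hat k v y\<bar> powr p)"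
      unfolding sum_distrib_left by (intro sum.cong) auto
    also have "\<dots> \<le> ?q ^ k * (2 * 2 ^ CARD('d) * ?m k)"
      using G in_grid_level p by (intro mult_left_mono hat_powr_sum_le) auto
    finally show "(\<Sum>v\<in>{v \<in> G. level v = k}. ?q ^ level v * \<bar>hat (level v) v x - hat (level v) v y\<bar> powr p)
        \<le> 2 * 2 ^ CARD('d) * (?q ^ k * ?m k)" by (simp only: mult.left_commute)
  qed
  also have "\<dots> = 2 * 2 ^ CARD('d) * (\<Sum>k\<in>level ` G. ?q ^ k * ?m k)" by (simp only: sum_distrib_left)
  also have "\<dots> \<le> 2 * 2 ^ CARD('d) * ((1 / (1 - 2 powr (- p * \<alpha>)) + 1 / (1 - 2 powr (p * (\<alpha> - 1))))
      * l1_norm (x - y) powr (p * \<alpha>))"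
    using G \<alpha> p t by (intro mult_left_mono sum_min_power_le) auto
  finally show ?thesis by (simp only: upper_const_def mult.assoc)
qed (use upper_const_nonneg in simp)

text \<open>Since p \<le> 1, the p-th power of a sum is at most the sum of the p-th powers. The sum
  over the representation moves outside, and the bound for one pair of points serves every
  representation with the same constant.\<close>

lemma hat_coeffs_cost:
  assumes "F.cost m r" and G: "finite G" "G \<subseteq> V"
  shows "(\<Sum>v\<in>G. \<bar>hat_coeffs m v\<bar> powr p) \<le> upper_const CARD('d) p \<alpha> * r"
proof -
  obtain n :: nat and a x y where r: "r = (\<Sum>i<n. \<bar>a i\<bar> powr p)"
    and xy: "\<forall>i<n. x i \<in> cbox 0 1 \<and> y i \<in> cbox 0 1 \<and> x i \<noteq> y i"
    and m: "m = (\<lambda>t. \<Sum>i<n. a i * ((delta 0 (x i) t - delta 0 (y i) t) / \<sigma> (x i) (y i)))"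
    using assms(1) unfolding molecular_cost_def by blast
  let ?h = "\<lambda>v. hat (level v) v"
  let ?b = "\<lambda>i. a i / \<sigma> (x i) (y i)"
  have m': "m = (\<lambda>t. \<Sum>i<n. ?b i * (delta 0 (x i) t - delta 0 (y i) t))"
    unfolding m by simp
  have coeff: "hat_coeffs m v = (\<Sum>i<n. ?b i * (weight v * (?h v (x i) - ?h v (y i))))" if "v \<in> V" for v
  proof -
    have "lin_ext (?h v) m = (\<Sum>i<n. ?b i * (?h v (x i) - ?h v (y i)))"
      by (simp only: m' lin_ext_sum finite_lessThan finite_support_delta_diff hat_level_0[OF that] lin_ext_delta_diff)
    then show ?thesis using that by (simp add: hat_coeffs_def sum_distrib_left mult_ac)
  qed
  have "(\<Sum>v\<in>G. \<bar>hat_coeffs m v\<bar> powr p)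
      \<le> (\<Sum>v\<in>G. \<Sum>i<n. \<bar>?b i\<bar> powr p * (weight v * \<bar>?h v (x i) - ?h v (y i)\<bar>) powr p)"
  proof (rule sum_mono)
    fix v assume "v \<in> G"
    then have "\<bar>hat_coeffs m v\<bar> powr p = \<bar>\<Sum>i<n. ?b i * (weight v * (?h v (x i) - ?h v (y i)))\<bar> powr p"
      using G coeff by auto
    also have "\<dots> \<le> (\<Sum>i<n. \<bar>?b i * (weight v * (?h v (x i) - ?h v (y i)))\<bar> powr p)"
      by (rule abs_powr_sum_le[OF p])
    also have "\<dots> = (\<Sum>i<n. \<bar>?b i\<bar> powr p * (weight v * \<bar>?h v (x i) - ?h v (y i)\<bar>) powr p)"
      using weight_pos[of v] by (simp only: abs_mult powr_mult abs_of_pos)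
    finally show "\<bar>hat_coeffs m v\<bar> powr p
        \<le> (\<Sum>i<n. \<bar>?b i\<bar> powr p * (weight v * \<bar>?h v (x i) - ?h v (y i)\<bar>) powr p)" .
  qed
  also have "\<dots> = (\<Sum>i<n. \<bar>?b i\<bar> powr p * (\<Sum>v\<in>G. (weight v * \<bar>?h v (x i) - ?h v (y i)\<bar>) powr p))"
    unfolding sum_distrib_left by (rule sum.swap)
  also have "\<dots> \<le> (\<Sum>i<n. \<bar>?b i\<bar> powr p * (upper_const CARD('d) p \<alpha> * \<sigma> (x i) (y i) powr p))"
    unfolding sigma_powr using G by (intro sum_mono mult_left_mono sum_hat_diff_le) auto
  also have "\<dots> = (\<Sum>i<n. upper_const CARD('d) p \<alpha> * \<bar>a i\<bar> powr p)"
  proof (rule sum.cong)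
    fix i assume "i \<in> {..<n}"
    then have "0 < \<sigma> (x i) (y i)" using xy F.pos by auto
    then have "\<bar>a i\<bar> powr p = (\<bar>?b i\<bar> * \<sigma> (x i) (y i)) powr p" by (simp add: abs_divide)
    then show "\<bar>?b i\<bar> powr p * (upper_const CARD('d) p \<alpha> * \<sigma> (x i) (y i) powr p) = upper_const CARD('d) p \<alpha> * \<bar>a i\<bar> powr p"
      by (simp only: powr_mult mult_ac)
  qed simp
  also have "\<dots> = upper_const CARD('d) p \<alpha> * r" by (simp add: r sum_distrib_left)
  finally show ?thesis .
qed

lemma hat_coeffs_upper:
  assumes m: "m \<in> vcarrier F.P"
  shows "hat_coeffs m \<in> vcarrier (lp_space p V)"
    "vnorm (lp_space p V) (hat_coeffs m) powr p \<le> upper_const CARD('d) p \<alpha> * vnorm F.P m powr p"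
proof -
  have "(\<Sum>v\<in>G. \<bar>hat_coeffs m v\<bar> powr p) \<le> upper_const CARD('d) p \<alpha> * vnorm F.P m powr p"
    if "finite G" "G \<subseteq> V" for G
    using m hat_coeffs_cost that upper_const_nonneg by (intro F.norm_powr_leI) auto
  note le = this
  have zero: "hat_coeffs m v = 0" if "v \<notin> V" for v using that by (simp add: hat_coeffs_def)
  show "hat_coeffs m \<in> vcarrier (lp_space p V)"
    using zero le by (rule lp_norm_leI(1)[OF p])
  show "vnorm (lp_space p V) (hat_coeffs m) powr p \<le> upper_const CARD('d) p \<alpha> * vnorm F.P m powr p"
    using zero le by (rule lp_norm_leI(2)[OF p])
qed

lemma hat_coeffs_add:
  assumes "finite {t. f t \<noteq> 0}" "finite {t. g t \<noteq> 0}"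
  shows "hat_coeffs (f + g) = hat_coeffs f + hat_coeffs g"
  using assms by (auto simp: hat_coeffs_def fun_eq_iff lin_ext_add distrib_left)

lemma hat_coeffs_scale:
  assumes "finite {t. f t \<noteq> 0}"
  shows "hat_coeffs (\<lambda>t. c * f t) = (\<lambda>t. c * hat_coeffs f t)"
  using assms by (auto simp: hat_coeffs_def fun_eq_iff lin_ext_scale)

lemma synth_add:
  assumes "finite {t. f t \<noteq> 0}" "finite {t. g t \<noteq> 0}"
  shows "synth (f + g) = synth f + synth g"
  using assms by (auto simp: synth_def fun_eq_iff lin_ext_add)

lemma synth_scale:
  assumes "finite {t. f t \<noteq> 0}"
  shows "synth (\<lambda>t. c * f t) = (\<lambda>t. c * synth f t)"
  using assms by (auto simp: synth_def fun_eq_iff lin_ext_scale)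

lemma delta_carrier: "x \<in> cbox 0 1 \<Longrightarrow> delta 0 x \<in> vcarrier F.P"
  by (auto simp: F.carrier_iff finite_support_delta) (auto simp: delta_def split: if_splits)

lemma sum_closed:
  assumes "\<And>i. i \<in> I \<Longrightarrow> f i \<in> vcarrier F.P"
  shows "(\<lambda>t. \<Sum>i\<in>I. c i * f i t) \<in> vcarrier F.P"
  using assms
proof (induction I rule: infinite_finite_induct)
  case (insert i I)
  then have "(\<lambda>t. c i * f i t) + (\<lambda>t. \<Sum>i\<in>I. c i * f i t) \<in> vcarrier F.P"
    by (intro P.add_closed P.scale_closed) auto
  then show ?case using insert by (simp add: plus_fun_def)
qed (use P.zero_closed in \<open>simp_all add: zero_fun_def\<close>)

lemma schauder_carrier:
  assumes "v \<in> V" shows "schauder v \<in> vcarrier F.P"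
proof (cases "level v = 0")
  case True
  then have "schauder v = delta 0 v" by (auto simp: schauder_def)
  then show ?thesis using delta_carrier[OF dyadic_in_cbox[OF assms]] by simp
next
  case False
  have "(\<lambda>t. \<Sum>S\<in>UNIV. 1 / 2 ^ CARD('d) * (delta 0 v - delta 0 (corner (level v - 1) v S)) t) \<in> vcarrier F.P"
    by (intro sum_closed P.diff_closed delta_carrier dyadic_in_cbox[OF assms]
        grid_in_cbox[OF corner_in_grid])
  then show ?thesis using False by (simp add: schauder_def)
qed

lemma schauder_cost:
  assumes v: "v \<in> V"
  shows "\<exists>r \<le> lower_const CARD('d) p \<alpha> * weight v powr p. F.cost (schauder v) r"
proof (cases "level v")
  case 0
  \<comment> \<open>At level 0 there is no coarser grid; the base point takes its place, at distance
    at most d, and the weight is 1.\<close>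
  have eq: "(\<lambda>t. delta 0 v t - delta 0 0 t) = schauder v" by (auto simp: schauder_def 0 delta_def)
  have "F.cost (schauder v) (\<sigma> v 0 powr p)"
    using F.cost_delta_diff[OF dyadic_in_cbox[OF v] F.base] dyadic_ne_0[OF v] eq by simp
  moreover have "\<sigma> v 0 powr p \<le> lower_const CARD('d) p \<alpha> * weight v powr p"
  proof -
    have "\<bar>v $ i\<bar> \<le> 1" for i using dyadic_in_cbox[OF v] by (simp add: mem_box_cart abs_le_iff)
    then have "l1_norm v \<le> real CARD('d)" using l1_norm_le[of v 1] by simp
    then have "l1_norm v powr (p * \<alpha>) \<le> real CARD('d) powr (p * \<alpha>)"
      using \<alpha> p l1_norm_nonneg by (intro powr_mono2) auto
    also have "\<dots> \<le> lower_const CARD('d) p \<alpha>"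
      using p ge_one_powr_ge_zero[of 2 "real CARD('d) * (1 - p)"] by (simp add: lower_const_def mult_right_mono mult_le_cancel_right1)
    finally show ?thesis unfolding sigma_powr weight_powr using 0 by simp
  qed
  ultimately show ?thesis by blast
next
  case (Suc k)
  let ?c = "\<lambda>S. corner k v S" and ?w = "1 / 2 ^ CARD('d) :: real"
  let ?r = "\<lambda>S. \<bar>?w\<bar> powr p * (if v = ?c S then 0 else \<sigma> v (?c S) powr p)"
  have vk: "v \<in> grid (Suc k)" using in_grid_level[OF v] Suc by simp
  have "F.cost (\<lambda>t. \<Sum>S\<in>UNIV. ?w * (delta 0 v t - delta 0 (?c S) t)) (\<Sum>S\<in>UNIV. ?r S)"
    using dyadic_in_cbox[OF v]
    by (intro F.cost_sum F.cost_scale F.cost_delta_diff grid_in_cbox[OF corner_in_grid])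
  then have "F.cost (schauder v) (\<Sum>S\<in>UNIV. ?r S)" by (simp add: schauder_def Suc)
  moreover have "(\<Sum>S\<in>UNIV. ?r S) \<le> lower_const CARD('d) p \<alpha> * weight v powr p"
  proof -
    have wt: "weight v powr p = (1 / 2 ^ Suc k) powr (p * \<alpha>)"
      unfolding weight_powr two_powr_power Suc by (simp add: powr_minus_divide powr_divide)
    have le: "?r S \<le> ?w powr p * (real CARD('d) powr (p * \<alpha>) * weight v powr p)" for S
    proof -
      have "l1_norm (v - ?c S) \<le> real CARD('d) * (1 / 2 ^ Suc k)" by (intro l1_norm_le corner_dist vk)
      then have "l1_norm (v - ?c S) powr (p * \<alpha>) \<le> (real CARD('d) * (1 / 2 ^ Suc k)) powr (p * \<alpha>)"
        using \<alpha> p l1_norm_nonneg by (intro powr_mono2) auto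
      then have "(if v = ?c S then 0 else \<sigma> v (?c S) powr p) \<le> real CARD('d) powr (p * \<alpha>) * weight v powr p"
        unfolding sigma_powr wt powr_mult by auto
      then show ?thesis by (intro mult_mono) auto
    qed
    have "card (UNIV :: 'd set set) = 2 ^ CARD('d)" by (simp flip: Pow_UNIV add: card_Pow)
    then have "(\<Sum>S\<in>UNIV. ?r S) \<le> 2 ^ CARD('d) * (?w powr p * (real CARD('d) powr (p * \<alpha>) * weight v powr p))"
      using sum_mono[of UNIV ?r "\<lambda>_. ?w powr p * (real CARD('d) powr (p * \<alpha>) * weight v powr p)"] le by simp
    also have "2 ^ CARD('d) * (?w powr p * (real CARD('d) powr (p * \<alpha>) * weight v powr p))
        = (2 ^ CARD('d) * ?w powr p) * real CARD('d) powr (p * \<alpha>) * weight v powr p" by simp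
    also have "2 ^ CARD('d) * ?w powr p = 2 powr (real CARD('d) * (1 - p))"
      by (simp add: powr_divide powr_powr powr_diff right_diff_distrib flip: powr_realpow)
    finally show ?thesis by (simp add: lower_const_def)
  qed
  ultimately show ?thesis by blast
qed

text \<open>
  Unlike the span of the \<^const>\<open>schauder\<close> vectors, this subspace needs no choice of expansion
  coefficients.
\<close>

definition reproduced :: "(real ^ 'd \<Rightarrow> real) set" where
  "reproduced = {m \<in> vcarrier F.P. finite {v. hat_coeffs m v \<noteq> 0} \<and> synth (hat_coeffs m) = m}"

section \<open>Functions recovered from their coefficients, and the lower bound\<close>

lemma reproduced_add:
  assumes "f \<in> reproduced" "g \<in> reproduced" shows "f + g \<in> reproduced"
proof -
  have c: "f \<in> vcarrier F.P" "g \<in> vcarrier F.P" using assms by (auto simp: reproduced_def)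
  have eq: "hat_coeffs (f + g) = hat_coeffs f + hat_coeffs g"
    using c by (intro hat_coeffs_add carrier_finite)
  have "finite {v. (hat_coeffs f + hat_coeffs g) v \<noteq> 0}"
    by (rule finite_subset[of _ "{v. hat_coeffs f v \<noteq> 0} \<union> {v. hat_coeffs g v \<noteq> 0}"])
      (use assms in \<open>auto simp: reproduced_def\<close>)
  then show ?thesis using assms c unfolding reproduced_def mem_Collect_eq eq by (auto simp: synth_add P.add_closed)
qed

lemma reproduced_scale:
  assumes "f \<in> reproduced" shows "(\<lambda>t. c * f t) \<in> reproduced"
proof -
  have c: "f \<in> vcarrier F.P" using assms by (auto simp: reproduced_def)
  have eq: "hat_coeffs (\<lambda>t. c * f t) = (\<lambda>v. c * hat_coeffs f v)"
    using c by (intro hat_coeffs_scale carrier_finite)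
  have "finite {v. c * hat_coeffs f v \<noteq> 0}"
    by (rule finite_subset[of _ "{v. hat_coeffs f v \<noteq> 0}"]) (use assms in \<open>auto simp: reproduced_def\<close>)
  then show ?thesis using assms c unfolding reproduced_def mem_Collect_eq eq by (auto simp: synth_scale P.scale_closed)
qed

lemma reproduced_zero: "(\<lambda>t. 0) \<in> reproduced"
  using P.zero_closed by (simp add: reproduced_def hat_coeffs_def synth_def lin_ext_def zero_fun_def)

lemma reproduced_sum:
  assumes "\<And>i. i \<in> I \<Longrightarrow> f i \<in> reproduced"
  shows "(\<lambda>t. \<Sum>i\<in>I. c i * f i t) \<in> reproduced"
  using assms
proof (induction I rule: infinite_finite_induct)
  case (insert i I)
  then have "(\<lambda>t. c i * f i t) + (\<lambda>t. \<Sum>i\<in>I. c i * f i t) \<in> reproduced"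
    by (intro reproduced_add reproduced_scale) auto
  then show ?case using insert by (simp add: plus_fun_def)
qed (simp_all add: reproduced_zero)

lemma hat_coeffs_schauder:
  assumes "v \<in> V" shows "hat_coeffs (schauder v) = (\<lambda>u. if u = v then weight v else 0)"
  using lin_ext_hat_schauder[OF _ assms] assms by (auto simp: hat_coeffs_def)

lemma reproduced_schauder:
  assumes v: "v \<in> V" shows "schauder v \<in> reproduced"
proof -
  have "synth (hat_coeffs (schauder v)) = schauder v"
  proof
    fix t
    have "synth (hat_coeffs (schauder v)) t =
        (\<Sum>u\<in>{v}. (if u = v then weight v else 0) * (schauder u t / weight u))"
      unfolding synth_def hat_coeffs_schauder[OF v] by (rule lin_ext_superset) auto
    then show "synth (hat_coeffs (schauder v)) t = schauder v t" using weight_pos[of v] by simp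
  qed
  moreover have "finite {u. hat_coeffs (schauder v) u \<noteq> 0}"
    by (rule finite_subset[of _ "{v}"]) (auto simp: hat_coeffs_schauder[OF v] split: if_splits)
  ultimately show ?thesis using schauder_carrier[OF v] by (simp add: reproduced_def)
qed

text \<open>Solving the definition of \<open>schauder x\<close> for \<delta>(x) leaves the mean of
  \<delta> over corners on a strictly coarser grid, so the claim follows by induction on the
  grid.\<close>

lemma reproduced_delta:
  assumes "x \<in> grid k" shows "delta 0 x \<in> reproduced"
  using assms
proof (induction k arbitrary: x rule: less_induct)
  case (less k)
  show ?case
  proof (cases "x = 0")
    case True
    then show ?thesis using reproduced_zero by (simp add: delta_def)
  next
    case False
    then have x: "x \<in> V" using less.prems by (auto simp: dyadic_points_eq)
    show ?thesis
    proof (cases "level x")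
      case 0
      then have "schauder x = delta 0 x" by (auto simp: schauder_def)
      then show ?thesis using reproduced_schauder[OF x] by simp
    next
      case (Suc j)
      have "j < k" using level_le[OF less.prems] Suc by simp
      have "delta 0 (corner j x S) \<in> reproduced" for S
        by (intro less.IH[OF \<open>j < k\<close>] corner_in_grid grid_in_cbox[OF less.prems])
      then have "schauder x + (\<lambda>t. \<Sum>S\<in>UNIV. 1 / 2 ^ CARD('d) * delta 0 (corner j x S) t) \<in> reproduced"
        by (intro reproduced_add reproduced_schauder x reproduced_sum)
      moreover have "schauder x + (\<lambda>t. \<Sum>S\<in>UNIV. 1 / 2 ^ CARD('d) * delta 0 (corner j x S) t) = delta 0 x"
      proof
        fix t
        have "card (UNIV :: 'd set set) = 2 ^ CARD('d)" by (simp flip: Pow_UNIV add: card_Pow)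
        then have "(\<Sum>S\<in>(UNIV :: 'd set set). 1 / 2 ^ CARD('d) * delta 0 x t) = delta 0 x t" by simp
        then show "(schauder x + (\<lambda>t. \<Sum>S\<in>UNIV. 1 / 2 ^ CARD('d) * delta 0 (corner j x S) t)) t = delta 0 x t"
          by (simp add: schauder_def Suc right_diff_distrib sum_subtractf diff_divide_distrib)
      qed
      ultimately show ?thesis by simp
    qed
  qed
qed

text \<open>A function equal to its own synthesis comes with an explicit representation, assembled
  from those of the basis vectors. The weights cancel between coefficient and cost.\<close>

lemma reproduced_lower:
  assumes "m \<in> reproduced"
  shows "vnorm F.P m powr p \<le> lower_const CARD('d) p \<alpha> * vnorm (lp_space p V) (hat_coeffs m) powr p"
proof -
  let ?g = "hat_coeffs m" and ?G = "{v. hat_coeffs m v \<noteq> 0}"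
  have m: "m \<in> vcarrier F.P" "finite ?G" "synth ?g = m" using assms by (auto simp: reproduced_def)
  have G: "?G \<subseteq> V" by (auto simp: hat_coeffs_def split: if_splits)
  from schauder_cost obtain r where
    r: "\<And>v. v \<in> V \<Longrightarrow> r v \<le> lower_const CARD('d) p \<alpha> * weight v powr p \<and> F.cost (schauder v) (r v)"
    by metis
  have "F.cost (\<lambda>t. \<Sum>v\<in>?G. ?g v / weight v * schauder v t) (\<Sum>v\<in>?G. \<bar>?g v / weight v\<bar> powr p * r v)"
    using r G by (intro F.cost_sum F.cost_scale) auto
  also have "(\<lambda>t. \<Sum>v\<in>?G. ?g v / weight v * schauder v t) = synth ?g"
    by (simp add: synth_def lin_ext_def)
  also have "synth ?g = m" by (fact m(3))
  finally have "vnorm F.P m powr p \<le> (\<Sum>v\<in>?G. \<bar>?g v / weight v\<bar> powr p * r v)"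
    by (rule F.norm_powr_le_cost)
  also have "\<dots> \<le> (\<Sum>v\<in>?G. lower_const CARD('d) p \<alpha> * \<bar>?g v\<bar> powr p)"
  proof (rule sum_mono)
    fix v assume "v \<in> ?G"
    then have "\<bar>?g v / weight v\<bar> powr p * r v \<le> \<bar>?g v / weight v\<bar> powr p * (lower_const CARD('d) p \<alpha> * weight v powr p)"
      using r G by (intro mult_left_mono) auto
    also have "\<dots> = lower_const CARD('d) p \<alpha> * (\<bar>?g v / weight v\<bar> * weight v) powr p" by (simp only: powr_mult mult_ac)
    also have "\<bar>?g v / weight v\<bar> * weight v = \<bar>?g v\<bar>" using weight_pos[of v] by (simp add: abs_divide)
    finally show "\<bar>?g v / weight v\<bar> powr p * r v \<le> lower_const CARD('d) p \<alpha> * \<bar>?g v\<bar> powr p" .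
  qed
  also have "\<dots> = lower_const CARD('d) p \<alpha> * (\<Sum>v\<in>?G. \<bar>?g v\<bar> powr p)" by (simp add: sum_distrib_left)
  also have "\<dots> \<le> lower_const CARD('d) p \<alpha> * vnorm (lp_space p V) ?g powr p"
    using lp_sum_le_norm[OF p hat_coeffs_upper(1)[OF m(1)] m(2) G] lower_const_nonneg by (rule mult_left_mono)
  finally show ?thesis .
qed

text \<open>Compare m with a rounded version m'. The lower estimate holds for m', and the
  coefficients of m and m' differ by those of m' - m, which the upper estimate bounds. The total
  error is a fixed multiple of the p-th power of the norm of m - m' and vanishes with the
  mesh.\<close>

lemma hat_coeffs_lower:
  assumes m: "m \<in> vcarrier F.P"
  shows "vnorm F.P m powr p \<le> lower_const CARD('d) p \<alpha> * vnorm (lp_space p V) (hat_coeffs m) powr p"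
proof -
  let ?X = "{x. m x \<noteq> 0}" and ?NP = "\<lambda>f. vnorm F.P f powr p"
    and ?NL = "\<lambda>f. vnorm (lp_space p V) f powr p"
  have X: "finite ?X" "?X \<subseteq> cbox 0 1" "m 0 = 0" using m by (auto simp: F.carrier_iff)
  \<comment> \<open>Support points are rounded down in all coordinates while their coefficients stay
    fixed, so the error is a combination, over a fixed finite set, of differences of \<delta> at
    points at distance at most d / 2^k.\<close>
  define approx where "approx k = (\<lambda>t. \<Sum>x\<in>?X. m x * delta 0 (corner k x {}) t)" for k
  define W where "W = (\<Sum>x\<in>?X. \<bar>m x\<bar> powr p)"
  let ?e = "\<lambda>k. W * (real CARD('d) * (1 / 2 ^ k)) powr (p * \<alpha>)"
  have rep: "approx k \<in> reproduced" for k
    unfolding approx_def using X by (intro reproduced_sum reproduced_delta[OF corner_in_grid]) auto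
  then have ac: "approx k \<in> vcarrier F.P" for k by (auto simp: reproduced_def)
  have close: "?NP (m - approx k) \<le> ?e k" for k
  proof -
    let ?r = "\<lambda>x. \<bar>m x\<bar> powr p * (if x = corner k x {} then 0 else \<sigma> x (corner k x {}) powr p)"
    have "F.cost (\<lambda>t. \<Sum>x\<in>?X. m x * (delta 0 x t - delta 0 (corner k x {}) t)) (\<Sum>x\<in>?X. ?r x)"
      using X by (intro F.cost_sum F.cost_scale F.cost_delta_diff grid_in_cbox[OF corner_in_grid]) auto
    also have "(\<lambda>t. \<Sum>x\<in>?X. m x * (delta 0 x t - delta 0 (corner k x {}) t)) = m - approx k"
    proof
      fix t
      show "(\<Sum>x\<in>?X. m x * (delta 0 x t - delta 0 (corner k x {}) t)) = (m - approx k) t"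
        using fun_cong[OF F.delta_expansion[OF X(1,3)], of t]
        by (simp add: approx_def right_diff_distrib sum_subtractf)
    qed
    finally have "?NP (m - approx k) \<le> (\<Sum>x\<in>?X. ?r x)" by (rule F.norm_powr_le_cost)
    also have "\<dots> \<le> (\<Sum>x\<in>?X. \<bar>m x\<bar> powr p * (real CARD('d) * (1 / 2 ^ k)) powr (p * \<alpha>))"
    proof (intro sum_mono mult_left_mono)
      fix x :: "real ^ 'd"
      have "l1_norm (x - corner k x {}) \<le> real CARD('d) * (1 / 2 ^ k)" by (intro l1_norm_le corner_approx)
      then have "l1_norm (x - corner k x {}) powr (p * \<alpha>) \<le> (real CARD('d) * (1 / 2 ^ k)) powr (p * \<alpha>)"
        using \<alpha> p l1_norm_nonneg by (intro powr_mono2) auto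
      then show "(if x = corner k x {} then 0 else \<sigma> x (corner k x {}) powr p) \<le> (real CARD('d) * (1 / 2 ^ k)) powr (p * \<alpha>)"
        unfolding sigma_powr by auto
    qed auto
    also have "\<dots> = ?e k" by (simp only: W_def sum_distrib_right)
    finally show ?thesis .
  qed
  have bound: "?NP m \<le> lower_const CARD('d) p \<alpha> * ?NL (hat_coeffs m) + (1 + lower_const CARD('d) p \<alpha> * upper_const CARD('d) p \<alpha>) * ?e k" for k
  proof -
    have d: "m - approx k \<in> vcarrier F.P" "approx k - m \<in> vcarrier F.P"
      using m ac by (auto intro: P.diff_closed)
    have "hat_coeffs (m + (approx k - m)) = hat_coeffs m + hat_coeffs (approx k - m)"
      by (intro hat_coeffs_add carrier_finite m d)
    then have "hat_coeffs (approx k) = hat_coeffs m + hat_coeffs (approx k - m)" by simp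
    then have "?NL (hat_coeffs (approx k)) \<le> ?NL (hat_coeffs m) + ?NL (hat_coeffs (approx k - m))"
      using L.norm_add[OF hat_coeffs_upper(1)[OF m] hat_coeffs_upper(1)[OF d(2)]] by simp
    also have "?NL (hat_coeffs (approx k - m)) \<le> upper_const CARD('d) p \<alpha> * ?NP (m - approx k)"
      using hat_coeffs_upper(2)[OF d(2)] P.norm_minus_commute[OF m ac] by simp
    finally have "?NL (hat_coeffs (approx k)) \<le> ?NL (hat_coeffs m) + upper_const CARD('d) p \<alpha> * ?NP (m - approx k)" by simp
    then have "lower_const CARD('d) p \<alpha> * ?NL (hat_coeffs (approx k)) \<le> lower_const CARD('d) p \<alpha> * (?NL (hat_coeffs m) + upper_const CARD('d) p \<alpha> * ?NP (m - approx k))"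
      using lower_const_nonneg by (rule mult_left_mono)
    moreover have "?NP m \<le> ?NP (m - approx k) + ?NP (approx k)"
      using P.norm_add[OF d(1) ac[of k]] by simp
    ultimately have "?NP m \<le> lower_const CARD('d) p \<alpha> * ?NL (hat_coeffs m) + (1 + lower_const CARD('d) p \<alpha> * upper_const CARD('d) p \<alpha>) * ?NP (m - approx k)"
      using reproduced_lower[OF rep[of k]] by (simp add: algebra_simps)
    also have "\<dots> \<le> lower_const CARD('d) p \<alpha> * ?NL (hat_coeffs m) + (1 + lower_const CARD('d) p \<alpha> * upper_const CARD('d) p \<alpha>) * ?e k"
      using close[of k] lower_const_nonneg upper_const_nonneg by (intro add_left_mono mult_left_mono) auto
    finally show ?thesis .
  qed
  have "(\<lambda>k. real CARD('d) * (1 / 2 ^ k)) \<longlonglongrightarrow> 0"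
    using tendsto_mult_right_zero[OF LIMSEQ_power_zero[of "1 / 2 :: real"]] by (simp add: power_divide)
  then have "(\<lambda>k. (real CARD('d) * (1 / 2 ^ k)) powr (p * \<alpha>)) \<longlonglongrightarrow> 0 powr (p * \<alpha>)"
    using \<alpha> p by (intro tendsto_powr2 always_eventually) auto
  note lim = this
  have "(\<lambda>k. lower_const CARD('d) p \<alpha> * ?NL (hat_coeffs m) + (1 + lower_const CARD('d) p \<alpha> * upper_const CARD('d) p \<alpha>) * ?e k)
      \<longlonglongrightarrow> lower_const CARD('d) p \<alpha> * ?NL (hat_coeffs m) + (1 + lower_const CARD('d) p \<alpha> * upper_const CARD('d) p \<alpha>) * (W * 0 powr (p * \<alpha>))"
    by (intro tendsto_add tendsto_mult tendsto_const lim)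
  then show ?thesis using bound LIMSEQ_le_const by (fastforce simp: powr_0)
qed

text \<open>By biorthogonality every finitely supported family is attained exactly, and such
  families are dense in l_p(V).\<close>

lemma hat_coeffs_dense:
  assumes y: "y \<in> vcarrier (lp_space p V)" and e: "0 < e"
  shows "\<exists>m\<in>vcarrier F.P. vnorm (lp_space p V) (hat_coeffs m - y) < e"
proof -
  obtain G where G: "finite G" "G \<subseteq> V"
    and close: "vnorm (lp_space p V) ((\<lambda>v. if v \<in> G then y v else 0) - y) < e"
    using lp_finite_support_dense[OF p y e] by blast
  let ?m = "\<lambda>t. \<Sum>v\<in>G. y v / weight v * schauder v t"
  have eq: "hat_coeffs ?m = (\<lambda>v. if v \<in> G then y v else 0)"
  proof
    fix u
    show "hat_coeffs ?m u = (if u \<in> G then y u else 0)"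
    proof (cases "u \<in> V")
      case True
      have "lin_ext (hat (level u) u) ?m = (\<Sum>v\<in>G. y v / weight v * (if u = v then 1 else 0))"
        using G by (subst lin_ext_sum)
          (auto intro!: sum.cong simp: lin_ext_hat_schauder[OF True] subset_iff intro: carrier_finite schauder_carrier)
      also have "\<dots> = (if u \<in> G then y u / weight u else 0)"
        using G by (simp add: if_distrib cong: if_cong)
      finally show ?thesis using True weight_pos[of u] by (simp add: hat_coeffs_def)
    qed (use G in \<open>auto simp: hat_coeffs_def\<close>)
  qed
  have "?m \<in> vcarrier F.P" using G schauder_carrier by (intro sum_closed) auto
  then show ?thesis using close by (intro bexI[of _ ?m]) (simp_all only: eq)
qed

lemma banach_mazur_le:
  "banach_mazur (lipschitz_free_space p (cbox 0 1) \<sigma> 0) (lp_space p V)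
    \<le> ereal (upper_const CARD('d) p \<alpha> powr (1 / p) * lower_const CARD('d) p \<alpha> powr (1 / p))"
  unfolding lipschitz_free_space_def
proof (rule banach_mazur_completion_le[OF P.pnormed_fun_space_axioms L.pnormed_fun_space_axioms, of hat_coeffs])
  have root: "a \<le> c powr (1 / p) * b" if "a powr p \<le> c * b powr p" "0 \<le> a" "0 \<le> b" "0 \<le> c" for a b c :: real
  proof -
    have "(a powr p) powr (1 / p) \<le> (c * b powr p) powr (1 / p)" using that p by (intro powr_mono2) auto
    then show ?thesis using that p by (simp add: powr_powr powr_mult)
  qed
  show "linear_map F.P (lp_space p V) hat_coeffs"
    unfolding linear_map_def P.vadd_plus L.vadd_plus P.vscale_apply L.vscale_apply
    using hat_coeffs_upper(1) hat_coeffs_add hat_coeffs_scale carrier_finite by auto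
  show "vnorm (lp_space p V) (hat_coeffs m) \<le> upper_const CARD('d) p \<alpha> powr (1 / p) * vnorm F.P m" if "m \<in> vcarrier F.P" for m
    using hat_coeffs_upper[OF that] upper_const_nonneg P.norm_nonneg[OF that] L.norm_nonneg by (intro root) auto
  show "vnorm F.P m \<le> lower_const CARD('d) p \<alpha> powr (1 / p) * vnorm (lp_space p V) (hat_coeffs m)" if "m \<in> vcarrier F.P" for m
    using hat_coeffs_lower[OF that] hat_coeffs_upper(1)[OF that] lower_const_nonneg P.norm_nonneg[OF that] L.norm_nonneg
    by (intro root) auto
  show "\<exists>a\<in>vcarrier (lp_space p V). (\<lambda>n. vnorm (lp_space p V) (s n - a)) \<longlonglongrightarrow> 0"
    if "s \<in> cauchy_seqs (lp_space p V)" for s by (rule lp_complete[OF p that])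
  show "y = 0" if "y \<in> vcarrier (lp_space p V)" "vnorm (lp_space p V) y = 0" for y
    by (rule lp_norm_eq_0[OF p that])
  show "\<exists>m\<in>vcarrier F.P. vnorm (lp_space p V) (hat_coeffs m - y) < e"
    if "y \<in> vcarrier (lp_space p V)" "0 < e" for y e by (rule hat_coeffs_dense[OF that])
qed auto

end

theorem mainTheorem3:
  fixes p \<alpha> :: real
  assumes "0 < \<alpha>" and "\<alpha> < 1" and "0 < p" and "p \<le> 1"
  shows "banach_mazur
           (lipschitz_free_space p (cbox 0 1) (\<lambda>x y :: real ^ 'd. l1_norm (x - y) powr \<alpha>) 0)
           (lp_space p (dyadic_points :: (real ^ 'd) set))
         \<le> ereal (Cconst p (2 ^ CARD('d)) * rho p \<alpha> ^ CARD('d) * tau CARD('d) p \<alpha> ^ CARD('d))"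
proof -
  interpret cube_free_space p \<alpha> "TYPE('d)" by unfold_locales (use assms in auto)
  have "1 \<le> CARD('d)" by (simp add: Suc_leI)
  from distortion_le_constant[OF assms this] show ?thesis
    by (intro order_trans[OF banach_mazur_le]) (simp add: upper_const_def lower_const_def)
qed

end
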